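(* Let $\Omega_0=(B,\mathbf x,rI_n,\mathbf Z)$ be a seed with $B=(0)_{n\times n}$, $Z_1(u)=\cdots=Z_n(u)$ and $r\in\mathbb Z_{>0}$. Let $c=Z_1(1)$ and $\varphi(\mathbf x)=(\varphi_1(\mathbf x),\dots,\varphi_n(\mathbf x))$ with $\varphi_k(\mathbf x)=\frac{x_k^2+c}{x_k}$ for $k\in[1,n]$. Then the invariant Laurent polynomial ring $\mathbb Q[\mathbf x^{\pm}]^{\mathcal G(\Omega_0)}$ is the polynomial ring in $S_{n,1}(\varphi(\mathbf x)),\dots,S_{n,n}(\varphi(\mathbf x))$, that is, $$\mathbb Q[\mathbf x^{\pm}]^{\mathcal G(\Omega_0)}=\mathbb Q[S_{n,1}(\varphi(\mathbf x)),\dots,S_{n,n}(\varphi(\mathbf x))],$$ where $S_{n,1},\dots,S_{n,n}$ are the elementary symmetric polynomials in $n$ variables.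
   Context: A seed is $\Omega=(B,\mathbf x,R,\mathbf Z)$: $B=(b_{ij})$ an $n\times n$ skew-symmetrizable integer matrix; $\mathbf x=(x_1,\dots,x_n)$ a tuple of free generators of $\mathbb Q(x_1,\dots,x_n)$ (the cluster); $R=\mathrm{diag}(r_1,\dots,r_n)$ with positive integers; $\mathbf Z=(Z_1,\dots,Z_n)$ with $Z_k(u)=\sum_{i=0}^{r_k}z_{k,i}u^i\in\mathbb Z_{\ge0}[u]$, $z_{k,i}=z_{k,r_k-i}$, $z_{k,0}=z_{k,r_k}=1$. With $B_s=(b_{1s},\dots,b_{ns})$ and $[\cdot]_+=\max\{\cdot,0\}$ componentwise, $P_{\Omega,s}(\mathbf x)=\sum_{i=0}^{r_s}z_{s,i}\mathbf x^{i[B_s]_++(r_s-i)[-B_s]_+}$. The mutation is $\mu_s(B,\mathbf x,R,\mathbf Z)=(B',\mathbf x',R,\mathbf Z)$ with $b'_{ij}=-b_{ij}$ if $i=s$ or $j=s$, $b'_{ij}=b_{ij}+r_s([b_{is}]_+b_{sj}+b_{is}[-b_{sj}]_+)$ otherwise, $x'_s=P_{\Omega,s}(\mathbf x)/x_s$, $x'_j=x_j$ for $j\neq s$. A permutation $\sigma\in\mathfrak S_n$ acts by $\sigma(B,\mathbf x,R,\mathbf Z)=((b_{\sigma(i)\sigma(j)}),(x_{\sigma(i)}),\mathrm{diag}(r_{\sigma(i)}),(Z_{\sigma(i)}))$; $\sigma\mu_s$ means first $\mu_s$, then $\sigma$. $\mathcal S(\Omega)=\{\sigma\mu_s\mid\sigma\mu_s(B,\mathbf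 x,R,\mathbf Z)=(\pm B,\mathbf x',R,\mathbf Z)\text{ for some }\mathbf x'\}$, and $\mathcal G(\Omega)$ is the group generated by $\mathcal S(\Omega)$; its elements $g$ are regarded as transformations of clusters $\mathbf x\mapsto g(\mathbf x)$. $\mathbb Q[\mathbf x^{\pm}]^{G}=\{F\in\mathbb Q[\mathbf x^{\pm}]\mid F(g(\mathbf x))=F(\mathbf x)\ \forall g\in G\}$. *)

theory Defs
  imports
    "HOL-Analysis.Cartesian_Space"
    "HOL-Algebra.Bij"
    "HOL-Algebra.Generated_Groups"
    "HOL-Computational_Algebra.Polynomial"
    "HOL-Library.Poly_Mapping"
begin

section \<open>Polynomials and Laurent polynomials over the rationals\<close>

text \<open>
  Polynomials over \<open>\<rat>\<close> in variables indexed by \<open>'v\<close> are finitely supported maps from exponent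
  vectors to coefficients; Laurent polynomials in variables indexed by \<open>'n\<close> allow exponents in \<open>\<int>\<close>.
  In both cases multiplication is the convolution product of \<^type>\<open>poly_mapping\<close>.
\<close>

type_synonym 'v rat_mpoly = "('v \<Rightarrow>\<^sub>0 nat) \<Rightarrow>\<^sub>0 rat"
type_synonym 'n rat_laurent = "('n \<Rightarrow>\<^sub>0 int) \<Rightarrow>\<^sub>0 rat"

definition mpolys_in :: "'v set \<Rightarrow> 'v rat_mpoly set" where
  "mpolys_in I = {p. \<forall>m \<in> Poly_Mapping.keys p. Poly_Mapping.keys m \<subseteq> I}"

definition mpoly_eval :: "'v rat_mpoly \<Rightarrow> ('v \<Rightarrow> 'a::field_char_0) \<Rightarrow> 'a" where
  "mpoly_eval p y = (\<Sum>m \<in> Poly_Mapping.keys p. of_rat (Poly_Mapping.lookup p m) *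
     (\<Prod>i \<in> Poly_Mapping.keys m. y i ^ Poly_Mapping.lookup m i))"

definition laurent_eval :: "'n rat_laurent \<Rightarrow> ('n \<Rightarrow> 'a::field_char_0) \<Rightarrow> 'a" where
  "laurent_eval F y = (\<Sum>m \<in> Poly_Mapping.keys F. of_rat (Poly_Mapping.lookup F m) *
     (\<Prod>i \<in> Poly_Mapping.keys m. y i powi Poly_Mapping.lookup m i))"

definition algebraically_independent :: "'v set \<Rightarrow> ('v \<Rightarrow> 'a::field_char_0) \<Rightarrow> bool" where
  "algebraically_independent I y \<longleftrightarrow> (\<forall>p \<in> mpolys_in I. mpoly_eval p y = 0 \<longrightarrow> p = 0)"

text \<open>The subring \<open>\<rat>[y\<^sub>i | i \<in> I]\<close> of the field \<open>'a\<close>.\<close>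

definition generated_algebra :: "'v set \<Rightarrow> ('v \<Rightarrow> 'a::field_char_0) \<Rightarrow> 'a set" where
  "generated_algebra I y = {mpoly_eval p y | p. p \<in> mpolys_in I}"

text \<open>\<open>S\<^sub>n\<^sub>,\<^sub>k\<close> evaluated at a tuple, where \<open>n = CARD('n)\<close>.\<close>

definition elem_sym :: "nat \<Rightarrow> ('n::finite \<Rightarrow> 'a::comm_ring_1) \<Rightarrow> 'a" where
  "elem_sym k y = (\<Sum>A | A \<subseteq> (UNIV :: 'n set) \<and> card A = k. \<Prod>i \<in> A. y i)"

section \<open>Seeds\<close>

text \<open>
  The index set \<open>[1,n]\<close> is the finite type \<open>'n\<close>. The ambient field \<open>\<rat>(x\<^sub>1,\<dots>,x\<^sub>n)\<close> is the type \<open>'a\<close>: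
  it is pinned down, up to isomorphism over \<open>\<rat>\<close>, by the requirement that it possesses a tuple of
  free generators indexed by \<open>'n\<close>. The nonnegativity of the coefficients of the \<open>Z\<^sub>k\<close> is expressed
  by the type \<^typ>\<open>nat poly\<close>.
\<close>

record ('n::finite, 'a) seed =
  exch_mat :: "int^'n^'n"
  cluster :: "'n \<Rightarrow> 'a"
  deg_mat :: "nat^'n^'n"
  exch_poly :: "'n \<Rightarrow> nat poly"

definition free_generators :: "('n \<Rightarrow> 'a::field_char_0) \<Rightarrow> bool" where
  "free_generators y \<longleftrightarrow> algebraically_independent UNIV y \<and>
     (\<forall>f. \<exists>p q. mpoly_eval q y \<noteq> 0 \<and> f = mpoly_eval p y / mpoly_eval q y)"

definition skew_symmetrizable :: "int^'n::finite^'n \<Rightarrow> bool" where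
  "skew_symmetrizable B \<longleftrightarrow>
     (\<exists>d :: 'n \<Rightarrow> int. (\<forall>i. d i > 0) \<and> (\<forall>i j. d i * B $ i $ j = - (d j * B $ j $ i)))"

definition is_seed :: "('n::finite, 'a::field_char_0) seed \<Rightarrow> bool" where
  "is_seed \<Omega> \<longleftrightarrow>
     skew_symmetrizable (exch_mat \<Omega>) \<and>
     free_generators (cluster \<Omega>) \<and>
     (\<forall>i j. i \<noteq> j \<longrightarrow> deg_mat \<Omega> $ i $ j = 0) \<and>
     (\<forall>k. deg_mat \<Omega> $ k $ k > 0) \<and>
     (\<forall>k. let r = deg_mat \<Omega> $ k $ k; Z = exch_poly \<Omega> k in
        degree Z = r \<and> coeff Z 0 = 1 \<and> coeff Z r = 1 \<and> (\<forall>i\<le>r. coeff Z i = coeff Z (r - i)))"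

text \<open>On integers, \<open>nat b\<close> is the positive part \<open>[b]\<^sub>+\<close>.\<close>

definition exchange_rhs :: "('n::finite, 'a::field_char_0) seed \<Rightarrow> 'n \<Rightarrow> 'a" where
  "exchange_rhs \<Omega> s = (let r = deg_mat \<Omega> $ s $ s in
     \<Sum>i\<le>r. of_nat (coeff (exch_poly \<Omega> s) i) *
       (\<Prod>j\<in>UNIV. cluster \<Omega> j ^
          (i * nat (exch_mat \<Omega> $ j $ s) + (r - i) * nat (- exch_mat \<Omega> $ j $ s))))"

definition mutate :: "'n \<Rightarrow> ('n::finite, 'a::field_char_0) seed \<Rightarrow> ('n, 'a) seed" where
  "mutate s \<Omega> = (let B = exch_mat \<Omega>; x = cluster \<Omega> in
     \<lparr> exch_mat = (\<chi> i j. if i = s \<or> j = s then - B $ i $ j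
          else B $ i $ j + int (deg_mat \<Omega> $ s $ s) *
            (max (B $ i $ s) 0 * B $ s $ j + B $ i $ s * max (- B $ s $ j) 0)),
       cluster = x(s := exchange_rhs \<Omega> s / x s),
       deg_mat = deg_mat \<Omega>,
       exch_poly = exch_poly \<Omega> \<rparr>)"

definition permute_seed :: "('n \<Rightarrow> 'n) \<Rightarrow> ('n::finite, 'a) seed \<Rightarrow> ('n, 'a) seed" where
  "permute_seed \<sigma> \<Omega> =
     \<lparr> exch_mat = (\<chi> i j. exch_mat \<Omega> $ \<sigma> i $ \<sigma> j),
       cluster = (\<lambda>i. cluster \<Omega> (\<sigma> i)),
       deg_mat = (\<chi> i j. deg_mat \<Omega> $ \<sigma> i $ \<sigma> j),
       exch_poly = (\<lambda>i. exch_poly \<Omega> (\<sigma> i)) \<rparr>"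

section \<open>The symmetry group and its invariants\<close>

definition seed_symmetries ::
    "('n::finite, 'a::field_char_0) seed \<Rightarrow> (('n, 'a) seed \<Rightarrow> ('n, 'a) seed) set" where
  "seed_symmetries \<Omega> = {permute_seed \<sigma> \<circ> mutate s | \<sigma> s. bij \<sigma> \<and>
     (\<exists>B' \<in> {exch_mat \<Omega>, - exch_mat \<Omega>}. \<exists>x'.
        permute_seed \<sigma> (mutate s \<Omega>) = \<Omega>\<lparr>exch_mat := B', cluster := x'\<rparr>)}"

definition clusters :: "('n \<Rightarrow> 'a::field_char_0) set" where
  "clusters = {y. free_generators y}"

text \<open>
  A symmetry is regarded as the transformation of clusters that applies it to the seed with the
  matrix, the degrees and the exchange polynomials of \<open>\<Omega>\<close> and a variable cluster \<open>y\<close>. Replacing the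
  matrix \<open>B\<close> by \<open>-B\<close> leaves this transformation unchanged, because \<open>z\<^sub>k\<^sub>,\<^sub>i = z\<^sub>k\<^sub>,\<^sub>r\<^sub>-\<^sub>i\<close>; hence composing
  transformations of clusters agrees with composing the underlying operations on seeds.
\<close>

definition cluster_action ::
    "('n::finite, 'a::field_char_0) seed \<Rightarrow> (('n, 'a) seed \<Rightarrow> ('n, 'a) seed) \<Rightarrow>
     ('n \<Rightarrow> 'a) \<Rightarrow> ('n \<Rightarrow> 'a)" where
  "cluster_action \<Omega> g = (\<lambda>y \<in> clusters. cluster (g (\<Omega>\<lparr>cluster := y\<rparr>)))"

definition symmetry_group ::
    "('n::finite, 'a::field_char_0) seed \<Rightarrow> (('n \<Rightarrow> 'a) \<Rightarrow> ('n \<Rightarrow> 'a)) set" where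
  "symmetry_group \<Omega> = generate (BijGroup clusters) (cluster_action \<Omega> ` seed_symmetries \<Omega>)"

text \<open>
  \<open>\<rat>[x\<^sup>\<plusminus>]\<^sup>G\<close> as a subring of the field \<open>'a\<close>: the Laurent polynomials are evaluated at the cluster \<open>x\<close>,
  which is injective when \<open>x\<close> is algebraically independent.
\<close>

definition invariant_laurent ::
    "(('n \<Rightarrow> 'a) \<Rightarrow> ('n \<Rightarrow> 'a)) set \<Rightarrow> ('n \<Rightarrow> 'a::field_char_0) \<Rightarrow> 'a set" where
  "invariant_laurent G x =
     {laurent_eval F x | F. \<forall>g \<in> G. laurent_eval F (g x) = laurent_eval F x}"

end

theory Submission
  imports Defs
begin

text \<open>
  For \<open>B = 0\<close> the symmetries act by \<open>x\<^sub>s \<mapsto> c / x\<^sub>s\<close> followed by a permutation of the variables. If a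
  Laurent polynomial is invariant, its set of exponents is therefore closed under sign changes and
  permutations of the coordinates, so its lexicographically leading exponent \<open>m\<close> is dominant:
  \<open>m\<^sub>1 \<ge> \<dots> \<ge> m\<^sub>n \<ge> 0\<close>. Since \<open>S\<^sub>n\<^sub>,\<^sub>k(\<phi>)\<close> leads with \<open>x\<^sub>1\<cdots>x\<^sub>k\<close>, the monomials in the
  \<open>S\<^sub>n\<^sub>,\<^sub>k(\<phi>)\<close> realise every dominant leading exponent exactly once. Existence lets one cancel the
  leading term of an invariant, which terminates because only finitely many dominant exponents lie
  below a given one; uniqueness makes these monomials linearly independent.
\<close>

section \<open>Evaluation of Laurent polynomials\<close>

abbreviation "lookup \<equiv> Poly_Mapping.lookup"
abbreviation "keys \<equiv> Poly_Mapping.keys"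
abbreviation "single \<equiv> Poly_Mapping.single"

text \<open>Polynomial and Laurent evaluation are both \<rat>-linear extensions of a map on
  monomials, so additivity and changes of exponents are treated once for both.\<close>

definition lin_ext :: "('b \<Rightarrow> 'a::field_char_0) \<Rightarrow> ('b \<Rightarrow>\<^sub>0 rat) \<Rightarrow> 'a" where
  "lin_ext f p = (\<Sum>m\<in>keys p. of_rat (lookup p m) * f m)"

lemma lin_ext_superset:
  assumes "finite S" "keys p \<subseteq> S"
  shows "lin_ext f p = (\<Sum>m\<in>S. of_rat (lookup p m) * f m)"
  unfolding lin_ext_def using assms
  by (intro sum.mono_neutral_left) (auto simp: in_keys_iff)

lemma lin_ext_zero [simp]: "lin_ext f 0 = 0"
  by (simp add: lin_ext_def)

lemma lin_ext_add: "lin_ext f (p + q) = lin_ext f p + lin_ext f q"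
proof -
  have "keys (p + q) \<subseteq> keys p \<union> keys q"
    by (rule Poly_Mapping.keys_add)
  then show ?thesis
    by (simp add: lin_ext_superset[where S = "keys p \<union> keys q"] lookup_add of_rat_add
        distrib_right sum.distrib)
qed

lemma lin_ext_single [simp]: "lin_ext f (single m a) = of_rat a * f m"
  by (simp add: lin_ext_def)

lemma lin_ext_sum: "lin_ext f (sum P A) = (\<Sum>i\<in>A. lin_ext f (P i))"
  by (induction A rule: infinite_finite_induct) (auto simp: lin_ext_add)

lemma lin_ext_diff: "lin_ext f (p - q) = lin_ext f p - lin_ext f q"
  by (metis add_diff_cancel diff_add_cancel lin_ext_add)

text \<open>Pushforward of coefficients along the exponent map \<open>\<pi>\<close>, weighted by
  \<open>d\<close>; coefficients of exponents with the same image add up. It serves for embedding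
  polynomials, for clearing denominators and for the action of the symmetries.\<close>

definition remap :: "('b \<Rightarrow> 'c) \<Rightarrow> ('b \<Rightarrow> rat) \<Rightarrow> ('b \<Rightarrow>\<^sub>0 rat) \<Rightarrow> ('c \<Rightarrow>\<^sub>0 rat)" where
  "remap \<pi> d p = (\<Sum>m\<in>keys p. single (\<pi> m) (d m * lookup p m))"

lemma lin_ext_remap: "lin_ext f (remap \<pi> d p) = lin_ext (\<lambda>m. of_rat (d m) * f (\<pi> m)) p"
  unfolding remap_def lin_ext_sum lin_ext_single lin_ext_def[of _ p]
  by (intro sum.cong refl) (simp add: of_rat_mult)

lemma lookup_remap:
  assumes "inj_on \<pi> (keys p)" "m \<in> keys p"
  shows "lookup (remap \<pi> d p) (\<pi> m) = d m * lookup p m"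
proof -
  have "lookup (remap \<pi> d p) (\<pi> m) = (\<Sum>k\<in>keys p. if k = m then d m * lookup p m else 0)"
    unfolding remap_def lookup_sum using assms
    by (intro sum.cong refl) (auto simp: lookup_single when_def inj_on_eq_iff)
  also have "\<dots> = d m * lookup p m"
    using assms by simp
  finally show ?thesis .
qed

text \<open>Injectivity of \<open>\<pi>\<close> rules out cancellation, so every coefficient
  survives up to the nonzero factor \<open>d m\<close>.\<close>

lemma remap_eq_0D:
  assumes "remap \<pi> d p = 0" "inj_on \<pi> (keys p)" "\<And>m. m \<in> keys p \<Longrightarrow> d m \<noteq> 0"
  shows "p = 0"
proof -
  have "m \<notin> keys p" for m
  proof
    assume m: "m \<in> keys p"
    then have "d m * lookup p m = 0"
      using lookup_remap[OF assms(2) m, of d] assms(1) by simp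
    with assms(3)[OF m] m show False
      by (simp add: in_keys_iff)
  qed
  then show ?thesis
    by (intro poly_mapping_eqI) (simp add: in_keys_iff)
qed

section \<open>Monomials and the ring operations under evaluation\<close>

definition mpoly_monomial :: "('v \<Rightarrow> 'a::field_char_0) \<Rightarrow> ('v \<Rightarrow>\<^sub>0 nat) \<Rightarrow> 'a" where
  "mpoly_monomial y m = (\<Prod>i\<in>keys m. y i ^ lookup m i)"

text \<open>Indices outside the support contribute the factor 1; taking the product over the whole
  index type makes the sum of two exponents a pointwise matter.\<close>

definition laurent_monomial :: "('n::finite \<Rightarrow> 'a::field_char_0) \<Rightarrow> ('n \<Rightarrow>\<^sub>0 int) \<Rightarrow> 'a" where
  "laurent_monomial y m = (\<Prod>i\<in>UNIV. y i powi lookup m i)"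

lemma mpoly_eval_lin_ext: "mpoly_eval p y = lin_ext (mpoly_monomial y) p"
  by (simp add: mpoly_eval_def lin_ext_def mpoly_monomial_def)

lemma laurent_eval_lin_ext: "laurent_eval F y = lin_ext (laurent_monomial y) F"
proof -
  have "(\<Prod>i\<in>keys m. y i powi lookup m i) = (\<Prod>i\<in>UNIV. y i powi lookup m i)" for m
    by (intro prod.mono_neutral_left) (auto simp: in_keys_iff)
  then show ?thesis
    by (simp add: laurent_eval_def lin_ext_def laurent_monomial_def)
qed

lemma mpoly_monomial_finite:
  fixes y :: "'n::finite \<Rightarrow> 'a::field_char_0"
  shows "mpoly_monomial y m = (\<Prod>i\<in>UNIV. y i ^ lookup m i)"
  unfolding mpoly_monomial_def by (intro prod.mono_neutral_left) (auto simp: in_keys_iff)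

lemma laurent_monomial_zero [simp]: "laurent_monomial y 0 = 1"
  by (simp add: laurent_monomial_def)

lemma laurent_monomial_add:
  assumes "\<And>i. y i \<noteq> 0"
  shows "laurent_monomial y (m + k) = laurent_monomial y m * laurent_monomial y k"
  by (simp add: laurent_monomial_def lookup_add power_int_add assms prod.distrib)

lemma laurent_monomial_single: "laurent_monomial y (single i a) = y i powi a"
proof -
  have "laurent_monomial y (single i a) = (\<Prod>j\<in>UNIV. if j = i then y i powi a else 1)"
    unfolding laurent_monomial_def
    by (intro prod.cong refl) (auto simp: lookup_single when_def)
  then show ?thesis by simp
qed

lemma laurent_eval_0 [simp]: "laurent_eval 0 y = 0"
  by (simp add: laurent_eval_def)

lemma laurent_eval_add: "laurent_eval (F + G) y = laurent_eval F y + laurent_eval G y"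
  for y :: "'n::finite \<Rightarrow> 'a::field_char_0"
  by (simp add: laurent_eval_lin_ext lin_ext_add)

lemma laurent_eval_diff: "laurent_eval (F - G) y = laurent_eval F y - laurent_eval G y"
  for y :: "'n::finite \<Rightarrow> 'a::field_char_0"
  by (simp add: laurent_eval_lin_ext lin_ext_diff)

lemma laurent_eval_sum: "laurent_eval (sum P A) y = (\<Sum>i\<in>A. laurent_eval (P i) y)"
  for y :: "'n::finite \<Rightarrow> 'a::field_char_0"
  by (simp add: laurent_eval_lin_ext lin_ext_sum)

lemma laurent_eval_single: "laurent_eval (single m a) y = of_rat a * laurent_monomial y m"
  by (simp add: laurent_eval_lin_ext)

lemma laurent_eval_1 [simp]: "laurent_eval 1 y = 1"
  for y :: "'n::finite \<Rightarrow> 'a::field_char_0"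
  by (simp flip: single_one add: laurent_eval_single)

lemma poly_mapping_sum_singles: "(\<Sum>m\<in>keys p. single m (lookup p m)) = p"
proof (rule poly_mapping_eqI)
  fix k
  have "lookup (\<Sum>m\<in>keys p. single m (lookup p m)) k
      = (\<Sum>m\<in>keys p. if m = k then lookup p k else 0)"
    unfolding lookup_sum by (intro sum.cong refl) (auto simp: lookup_single when_def)
  then show "lookup (\<Sum>m\<in>keys p. single m (lookup p m)) k = lookup p k"
    by (auto simp: in_keys_iff)
qed

lemma poly_mapping_mult_eq_sum_singles:
  "F * G = (\<Sum>m\<in>keys F. \<Sum>k\<in>keys G. single (m + k) (lookup F m * lookup G k))"
  for F G :: "('b::monoid_add) \<Rightarrow>\<^sub>0 ('c::semiring_0)"
proof -
  have "F * G = (\<Sum>m\<in>keys F. single m (lookup F m)) * (\<Sum>k\<in>keys G. single k (lookup G k))"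
    by (simp only: poly_mapping_sum_singles)
  then show ?thesis
    by (simp only: sum_product mult_single)
qed

text \<open>By bilinearity this reduces to monomials, where \<open>powi\<close> turns sums of
  exponents into products. At 0 that law fails for exponents of opposite sign, whence the assumption
  on \<open>y\<close>.\<close>

lemma laurent_eval_mult:
  fixes y :: "'n::finite \<Rightarrow> 'a::field_char_0"
  assumes y: "\<And>i. y i \<noteq> 0"
  shows "laurent_eval (F * G) y = laurent_eval F y * laurent_eval G y"
proof -
  have "laurent_eval (F * G) y = (\<Sum>m\<in>keys F. \<Sum>k\<in>keys G.
      (of_rat (lookup F m) * laurent_monomial y m) * (of_rat (lookup G k) * laurent_monomial y k))"
    unfolding poly_mapping_mult_eq_sum_singles[of F G]
    by (simp only: laurent_eval_sum laurent_eval_single laurent_monomial_add[OF y] of_rat_mult mult_ac)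
  also have "\<dots> = laurent_eval F y * laurent_eval G y"
    by (simp only: laurent_eval_lin_ext lin_ext_def sum_product)
  finally show ?thesis .
qed

lemma laurent_eval_prod:
  fixes y :: "'n::finite \<Rightarrow> 'a::field_char_0"
  assumes "\<And>i. y i \<noteq> 0"
  shows "laurent_eval (prod P A) y = (\<Prod>i\<in>A. laurent_eval (P i) y)"
  by (induction A rule: infinite_finite_induct) (auto simp: laurent_eval_mult assms)

lemma laurent_eval_power:
  fixes y :: "'n::finite \<Rightarrow> 'a::field_char_0"
  assumes "\<And>i. y i \<noteq> 0"
  shows "laurent_eval (F ^ k) y = laurent_eval F y ^ k"
  by (induction k) (auto simp: laurent_eval_mult assms)

section \<open>Free generators in terms of Laurent polynomials\<close>

definition laurent_independent :: "('n::finite \<Rightarrow> 'a::field_char_0) \<Rightarrow> bool" where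
  "laurent_independent y \<longleftrightarrow> (\<forall>F. laurent_eval F y = 0 \<longrightarrow> F = 0)"

lemma lookup_Abs_finite [simp]: "lookup (Abs_poly_mapping f) = f"
  for f :: "'n::finite \<Rightarrow> 'b::zero"
  by (intro lookup_Abs_poly_mapping) simp

lemma mpoly_as_laurent:
  fixes p :: "'n::finite rat_mpoly"
  shows "\<exists>F. (\<forall>y :: 'n \<Rightarrow> 'a::field_char_0. laurent_eval F y = mpoly_eval p y) \<and> (F = 0 \<longrightarrow> p = 0)"
proof (intro exI conjI allI impI)
  define \<pi> :: "('n \<Rightarrow>\<^sub>0 nat) \<Rightarrow> ('n \<Rightarrow>\<^sub>0 int)" where
    "\<pi> m = Abs_poly_mapping (\<lambda>i. int (lookup m i))" for m
  have inj: "inj_on \<pi> (keys p)"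
  proof (intro inj_onI poly_mapping_eqI)
    fix m k i assume "\<pi> m = \<pi> k"
    from arg_cong[OF this, of "\<lambda>l. lookup l i"] show "lookup m i = lookup k i"
      by (simp add: \<pi>_def)
  qed
  show "p = 0" if "remap \<pi> (\<lambda>_. 1) p = 0"
    by (rule remap_eq_0D[OF that inj]) simp
  have monomial: "laurent_monomial y (\<pi> m) = mpoly_monomial y m" for m and y :: "'n \<Rightarrow> 'a"
    by (simp add: laurent_monomial_def mpoly_monomial_finite \<pi>_def)
  show "laurent_eval (remap \<pi> (\<lambda>_. 1) p) y = mpoly_eval p y" for y :: "'n \<Rightarrow> 'a"
    unfolding laurent_eval_lin_ext lin_ext_remap mpoly_eval_lin_ext monomial of_rat_1 mult_1 ..
qed

text \<open>Multiplying by a high power of the product of all variables shifts every exponent by the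
  same amount, an injective operation that makes all exponents nonnegative.\<close>

lemma laurent_clear_denominators:
  fixes F :: "'n::finite rat_laurent"
  shows "\<exists>p N. (\<forall>y :: 'n \<Rightarrow> 'a::field_char_0. (\<forall>i. y i \<noteq> 0) \<longrightarrow>
       mpoly_eval p y = laurent_eval F y * (\<Prod>i\<in>UNIV. y i) ^ N) \<and> (p = 0 \<longrightarrow> F = 0)"
proof -
  \<comment> \<open>The largest order of a pole of \<open>F\<close> in any variable; the inserted 0
    keeps \<open>Max\<close> meaningful when \<open>F = 0\<close>.\<close>
  define N where "N = Max (insert 0 ((\<lambda>(m, i). nat (- lookup m i)) ` (keys F \<times> UNIV)))"
  have N: "0 \<le> lookup m i + int N" if "m \<in> keys F" for m i
  proof -
    have "nat (- lookup m i) \<le> N"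
      unfolding N_def using that by (intro Max_ge) (auto intro: rev_image_eqI)
    then show ?thesis by linarith
  qed
  define \<pi> :: "('n \<Rightarrow>\<^sub>0 int) \<Rightarrow> ('n \<Rightarrow>\<^sub>0 nat)" where
    "\<pi> m = Abs_poly_mapping (\<lambda>i. nat (lookup m i + int N))" for m
  have inj: "inj_on \<pi> (keys F)"
  proof (intro inj_onI poly_mapping_eqI)
    fix m k i assume "m \<in> keys F" "k \<in> keys F" "\<pi> m = \<pi> k"
    from arg_cong[OF this(3), of "\<lambda>l. lookup l i"]
    have "nat (lookup m i + int N) = nat (lookup k i + int N)"
      by (simp add: \<pi>_def)
    with N[OF \<open>m \<in> keys F\<close>] N[OF \<open>k \<in> keys F\<close>] show "lookup m i = lookup k i"
      by (simp add: eq_nat_nat_iff)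
  qed
  have "F = 0" if "remap \<pi> (\<lambda>_. 1) F = 0"
    by (rule remap_eq_0D[OF that inj]) simp
  moreover have "mpoly_eval (remap \<pi> (\<lambda>_. 1) F) y = laurent_eval F y * (\<Prod>i\<in>UNIV. y i) ^ N"
    if y: "\<forall>i. y i \<noteq> 0" for y :: "'n \<Rightarrow> 'a"
  proof -
    have "mpoly_monomial y (\<pi> m) = laurent_monomial y m * (\<Prod>i\<in>UNIV. y i) ^ N"
      if "m \<in> keys F" for m
    proof -
      have "y i ^ nat (lookup m i + int N) = y i powi lookup m i * y i ^ N" for i
        using N[OF that, of i] y
        by (metis power_int_add power_int_of_nat nat_0_le)
      then show ?thesis
        by (simp add: mpoly_monomial_finite laurent_monomial_def \<pi>_def prod.distrib prod_power_distrib)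
    qed
    then show ?thesis
      unfolding mpoly_eval_lin_ext lin_ext_remap laurent_eval_lin_ext
      by (simp add: lin_ext_def sum_distrib_right mult.assoc)
  qed
  ultimately show ?thesis
    by (intro exI[of _ "remap \<pi> (\<lambda>_. 1) F"] exI[of _ N]) simp
qed

lemma algebraically_independent_nonzero:
  fixes y :: "'n::finite \<Rightarrow> 'a::field_char_0"
  assumes "algebraically_independent UNIV y"
  shows "y i \<noteq> 0"
proof
  assume "y i = 0"
  then have "mpoly_eval (single (single i 1) 1) y = 0"
    by (simp add: mpoly_eval_lin_ext mpoly_monomial_def)
  with assms have "single (single i (1::nat)) (1::rat) = 0"
    by (auto simp: algebraically_independent_def mpolys_in_def)
  then show False
    by (metis lookup_single_eq lookup_zero zero_neq_one)
qed

text \<open>A Laurent relation becomes a polynomial one by clearing denominators, and a polynomial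
  relation is a Laurent one. The Laurent form suits exchanges, which invert a variable.\<close>

lemma algebraically_independent_iff_laurent:
  fixes y :: "'n::finite \<Rightarrow> 'a::field_char_0"
  shows "algebraically_independent UNIV y \<longleftrightarrow> (\<forall>i. y i \<noteq> 0) \<and> laurent_independent y"
proof (intro iffI conjI allI)
  assume ind: "algebraically_independent UNIV y"
  then show nz: "y i \<noteq> 0" for i
    by (rule algebraically_independent_nonzero)
  show "laurent_independent y"
    unfolding laurent_independent_def
  proof (intro allI impI)
    fix F assume "laurent_eval F y = 0"
    obtain p N where
      p: "\<forall>z :: 'n \<Rightarrow> 'a. (\<forall>i. z i \<noteq> 0) \<longrightarrow> mpoly_eval p z = laurent_eval F z * (\<Prod>i\<in>UNIV. z i) ^ N"
      and "p = 0 \<longrightarrow> F = 0"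
      using laurent_clear_denominators[of F, where ?'a = 'a] by blast
    with p nz \<open>laurent_eval F y = 0\<close> ind show "F = 0"
      by (auto simp: algebraically_independent_def mpolys_in_def)
  qed
next
  assume y: "(\<forall>i. y i \<noteq> 0) \<and> laurent_independent y"
  show "algebraically_independent UNIV y"
    unfolding algebraically_independent_def
  proof (intro ballI impI)
    fix p assume "mpoly_eval p y = 0"
    obtain F where F: "\<forall>z :: 'n \<Rightarrow> 'a. laurent_eval F z = mpoly_eval p z" "F = 0 \<longrightarrow> p = 0"
      using mpoly_as_laurent[of p, where ?'a = 'a] by blast
    with \<open>mpoly_eval p y = 0\<close> y show "p = 0"
      by (auto simp: laurent_independent_def)
  qed
qed

text \<open>Polynomials and Laurent polynomials have the same fractions, so generation of the field
  can also be tested with Laurent polynomials.\<close>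

lemma free_generators_iff_laurent:
  fixes y :: "'n::finite \<Rightarrow> 'a::field_char_0"
  shows "free_generators y \<longleftrightarrow> (\<forall>i. y i \<noteq> 0) \<and> laurent_independent y \<and>
    (\<forall>f. \<exists>F G. laurent_eval G y \<noteq> 0 \<and> f = laurent_eval F y / laurent_eval G y)"
proof -
  have "(\<exists>p q. mpoly_eval q y \<noteq> 0 \<and> f = mpoly_eval p y / mpoly_eval q y) \<longleftrightarrow>
      (\<exists>F G. laurent_eval G y \<noteq> 0 \<and> f = laurent_eval F y / laurent_eval G y)" (is "?M \<longleftrightarrow> ?L")
    if nz: "\<And>i. y i \<noteq> 0" for f
  proof
    assume ?M
    then obtain p q where pq: "mpoly_eval q y \<noteq> 0" "f = mpoly_eval p y / mpoly_eval q y"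
      by blast
    obtain F where F: "\<forall>z :: 'n \<Rightarrow> 'a. laurent_eval F z = mpoly_eval p z" "F = 0 \<longrightarrow> p = 0"
      using mpoly_as_laurent[of p, where ?'a = 'a] by blast
    moreover obtain G where G: "\<forall>z :: 'n \<Rightarrow> 'a. laurent_eval G z = mpoly_eval q z" "G = 0 \<longrightarrow> q = 0"
      using mpoly_as_laurent[of q, where ?'a = 'a] by blast
    ultimately show ?L
      using pq by (intro exI[of _ F] exI[of _ G]) simp
  next
    assume ?L
    then obtain F G where FG: "laurent_eval G y \<noteq> 0" "f = laurent_eval F y / laurent_eval G y"
      by blast
    let ?X = "\<Prod>i\<in>UNIV. y i"
    obtain p M where p: "\<forall>z :: 'n \<Rightarrow> 'a. (\<forall>i. z i \<noteq> 0) \<longrightarrow>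
        mpoly_eval p z = laurent_eval F z * (\<Prod>i\<in>UNIV. z i) ^ M" "p = 0 \<longrightarrow> F = 0"
      using laurent_clear_denominators[of F, where ?'a = 'a] by blast
    obtain q N where q: "\<forall>z :: 'n \<Rightarrow> 'a. (\<forall>i. z i \<noteq> 0) \<longrightarrow>
        mpoly_eval q z = laurent_eval G z * (\<Prod>i\<in>UNIV. z i) ^ N" "q = 0 \<longrightarrow> G = 0"
      using laurent_clear_denominators[of G, where ?'a = 'a] by blast
    \<comment> \<open>Clearing denominators may use different powers \<open>M\<close> and
      \<open>N\<close> for numerator and denominator. A further shift by \<open>N\<close> and
      \<open>M\<close> respectively gives both the power \<open>M + N\<close>, which cancels in the
      quotient.\<close>
    have shift: "mpoly_eval (remap (\<lambda>m. m + Abs_poly_mapping (\<lambda>_. k)) (\<lambda>_. 1) p') y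
        = mpoly_eval p' y * ?X ^ k" for p' k
      by (simp add: mpoly_eval_lin_ext lin_ext_remap mpoly_monomial_finite lookup_add power_add
          prod.distrib prod_power_distrib)
        (simp add: lin_ext_def sum_distrib_right mult.assoc mpoly_monomial_finite)
    have "?X \<noteq> 0" using nz by simp
    then show ?M
      using FG p(1)[rule_format, OF nz] q(1)[rule_format, OF nz] shift[of N p] shift[of M q]
      by (intro exI[of _ "remap (\<lambda>m. m + Abs_poly_mapping (\<lambda>_. N)) (\<lambda>_. 1) p"]
          exI[of _ "remap (\<lambda>m. m + Abs_poly_mapping (\<lambda>_. M)) (\<lambda>_. 1) q"]) (simp add: mult_ac)
  qed
  then show ?thesis
    unfolding free_generators_def algebraically_independent_iff_laurent by blast
qed

section \<open>The action on clusters\<close>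

abbreviation perm_inv :: "('n \<Rightarrow> 'n) \<Rightarrow> 'n \<Rightarrow> 'n" where
  "perm_inv \<equiv> inv_into UNIV"

text \<open>The action of \<open>\<sigma>\<mu>\<^sub>s\<close> on clusters when \<open>B = 0\<close>, with \<open>c = Z\<^sub>s(1)\<close>.\<close>

definition exchange :: "'a::field_char_0 \<Rightarrow> ('n \<Rightarrow> 'n) \<Rightarrow> 'n \<Rightarrow> ('n \<Rightarrow> 'a) \<Rightarrow> ('n \<Rightarrow> 'a)" where
  "exchange c \<sigma> s y = (\<lambda>i. (y(s := c / y s)) (\<sigma> i))"

text \<open>The exponent of a monomial after substituting \<open>exchange c \<sigma> s y\<close>:
  position \<open>i\<close> reads variable \<open>\<sigma> i\<close>, so exponents travel along the
  inverse permutation, and inverting variable \<open>s\<close> flips its sign.\<close>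

definition exchange_exponent :: "('n::finite \<Rightarrow> 'n) \<Rightarrow> 'n \<Rightarrow> ('n \<Rightarrow>\<^sub>0 int) \<Rightarrow> ('n \<Rightarrow>\<^sub>0 int)" where
  "exchange_exponent \<sigma> s m =
     Abs_poly_mapping (\<lambda>j. if j = s then - lookup m (perm_inv \<sigma> j) else lookup m (perm_inv \<sigma> j))"

text \<open>The pullback of a Laurent polynomial along an exchange. Variable \<open>s\<close> is
  read at position \<open>perm_inv \<sigma> s\<close>, and the numerator of \<open>q / y s\<close>
  leaves that power of \<open>q\<close>.\<close>

definition exchange_laurent :: "rat \<Rightarrow> ('n::finite \<Rightarrow> 'n) \<Rightarrow> 'n \<Rightarrow> 'n rat_laurent \<Rightarrow> 'n rat_laurent" where
  "exchange_laurent q \<sigma> s = remap (exchange_exponent \<sigma> s) (\<lambda>m. q powi lookup m (perm_inv \<sigma> s))"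

lemma inj_exchange_exponent:
  fixes \<sigma> :: "'n::finite \<Rightarrow> 'n"
  assumes "bij \<sigma>"
  shows "inj (exchange_exponent \<sigma> s)"
proof (intro injI poly_mapping_eqI)
  fix m k :: "'n \<Rightarrow>\<^sub>0 int" and i
  assume "exchange_exponent \<sigma> s m = exchange_exponent \<sigma> s k"
  from arg_cong[OF this, of "\<lambda>l. lookup l (\<sigma> i)"]
  have "lookup m (perm_inv \<sigma> (\<sigma> i)) = lookup k (perm_inv \<sigma> (\<sigma> i))"
    by (simp add: exchange_exponent_def split: if_splits)
  then show "lookup m i = lookup k i"
    using assms by (simp add: bij_is_inj)
qed

lemma laurent_monomial_exchange:
  fixes y :: "'n::finite \<Rightarrow> 'a::field_char_0"
  assumes "bij \<sigma>" "\<And>i. y i \<noteq> 0" "c \<noteq> 0"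
  shows "laurent_monomial (exchange c \<sigma> s y) m
    = c powi lookup m (perm_inv \<sigma> s) * laurent_monomial y (exchange_exponent \<sigma> s m)"
proof -
  \<comment> \<open>Each factor is written as a function of \<open>\<sigma> i\<close> alone, ready
    for reindexing along \<open>\<sigma>\<close>.\<close>
  have "laurent_monomial (exchange c \<sigma> s y) m
      = (\<Prod>i\<in>UNIV. (\<lambda>j. (y(s := c / y s)) j powi lookup m (perm_inv \<sigma> j)) (\<sigma> i))"
    using assms(1) by (simp add: laurent_monomial_def exchange_def bij_is_inj inv_f_f del: fun_upd_apply)
  also have "\<dots> = (\<Prod>j\<in>UNIV. (y(s := c / y s)) j powi lookup m (perm_inv \<sigma> j))"
    using assms(1) by (rule prod.reindex_bij_betw)
  also have "\<dots> = (\<Prod>j\<in>UNIV. (if j = s then c powi lookup m (perm_inv \<sigma> s) else 1) *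
      y j powi lookup (exchange_exponent \<sigma> s m) j)"
    by (intro prod.cong refl)
      (auto simp: exchange_exponent_def divide_inverse power_int_mult_distrib power_int_inverse power_int_minus)
  also have "\<dots> = c powi lookup m (perm_inv \<sigma> s) * laurent_monomial y (exchange_exponent \<sigma> s m)"
    by (simp add: prod.distrib laurent_monomial_def)
  finally show ?thesis .
qed

lemma of_rat_power_int: "of_rat (a powi k) = (of_rat a :: 'a::field_char_0) powi k"
  by (simp add: power_int_def of_rat_power of_rat_inverse)

lemma laurent_eval_exchange:
  fixes y :: "'n::finite \<Rightarrow> 'a::field_char_0"
  assumes "bij \<sigma>" "\<And>i. y i \<noteq> 0" "q \<noteq> 0"
  shows "laurent_eval F (exchange (of_rat q) \<sigma> s y) = laurent_eval (exchange_laurent q \<sigma> s F) y"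
proof -
  have "laurent_monomial (exchange (of_rat q) \<sigma> s y)
      = (\<lambda>m. of_rat (q powi lookup m (perm_inv \<sigma> s)) * laurent_monomial y (exchange_exponent \<sigma> s m))"
    using assms by (intro ext) (simp add: laurent_monomial_exchange of_rat_power_int)
  then show ?thesis
    by (simp add: laurent_eval_lin_ext exchange_laurent_def lin_ext_remap)
qed

lemma exchange_laurent_eq_0D:
  assumes "exchange_laurent q \<sigma> s F = 0" "bij \<sigma>" "q \<noteq> 0"
  shows "F = 0"
proof (rule remap_eq_0D)
  show "remap (exchange_exponent \<sigma> s) (\<lambda>m. q powi lookup m (perm_inv \<sigma> s)) F = 0"
    using assms(1) by (simp add: exchange_laurent_def)
  show "inj_on (exchange_exponent \<sigma> s) (keys F)"
    using inj_exchange_exponent[OF assms(2)] by (rule inj_on_subset) simp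
  show "q powi lookup m (perm_inv \<sigma> s) \<noteq> 0" for m
    using assms(3) by simp
qed

lemma exchange_exponent_in_keys:
  assumes "bij \<sigma>" "q \<noteq> 0" "m \<in> keys F"
  shows "exchange_exponent \<sigma> s m \<in> keys (exchange_laurent q \<sigma> s F)"
proof -
  have "inj_on (exchange_exponent \<sigma> s) (keys F)"
    using inj_exchange_exponent[OF assms(1)] by (rule inj_on_subset) simp
  from lookup_remap[OF this assms(3)] assms(2,3) show ?thesis
    by (simp add: in_keys_iff exchange_laurent_def)
qed

lemma exchange_nonzero:
  assumes "\<And>i. y i \<noteq> 0" "c \<noteq> 0"
  shows "exchange c \<sigma> s y i \<noteq> 0"
  using assms by (simp add: exchange_def)

text \<open>The inverse of an exchange is again an exchange: after the permutation, the value
  \<open>c / y s\<close> sits at position \<open>perm_inv \<sigma> s\<close>, and a second inversion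
  there restores \<open>y s\<close>.\<close>

lemma exchange_inverse:
  assumes "bij \<sigma>" "\<And>i. y i \<noteq> 0" "c \<noteq> 0"
  shows "exchange c (perm_inv \<sigma>) (perm_inv \<sigma> s) (exchange c \<sigma> s y) = y"
proof
  fix i
  have "perm_inv \<sigma> i = perm_inv \<sigma> s \<longleftrightarrow> i = s"
    using assms(1) by (metis bij_inv_eq_iff)
  then show "exchange c (perm_inv \<sigma>) (perm_inv \<sigma> s) (exchange c \<sigma> s y) i = y i"
    using assms by (simp add: exchange_def bij_is_surj surj_f_inv_f)
qed

text \<open>Independence survives because the pullback of Laurent polynomials is injective;
  generation survives because the inverse exchange recovers the old variables from the new
  ones.\<close>

lemma exchange_in_clusters:
  fixes y :: "'n::finite \<Rightarrow> 'a::field_char_0"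
  assumes \<sigma>: "bij \<sigma>" and q: "q \<noteq> 0" and y: "y \<in> clusters"
  shows "exchange (of_rat q) \<sigma> s y \<in> clusters"
proof -
  let ?y' = "exchange (of_rat q) \<sigma> s y"
  have nz: "\<And>i. y i \<noteq> 0" and ind: "laurent_independent y"
    and gen: "\<And>f. \<exists>F G. laurent_eval G y \<noteq> 0 \<and> f = laurent_eval F y / laurent_eval G y"
    using y by (auto simp: clusters_def free_generators_iff_laurent)
  have nz': "?y' i \<noteq> 0" for i
    using nz q by (intro exchange_nonzero) auto
  have "laurent_independent ?y'"
    unfolding laurent_independent_def
  proof (intro allI impI)
    fix F assume "laurent_eval F ?y' = 0"
    then have "exchange_laurent q \<sigma> s F = 0"
      using ind by (simp add: laurent_eval_exchange \<sigma> nz q laurent_independent_def)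
    then show "F = 0"
      using exchange_laurent_eq_0D \<sigma> q by blast
  qed
  moreover have "\<exists>F G. laurent_eval G ?y' \<noteq> 0 \<and> f = laurent_eval F ?y' / laurent_eval G ?y'" for f
  proof -
    have pullback: "laurent_eval F y = laurent_eval (exchange_laurent q (perm_inv \<sigma>) (perm_inv \<sigma> s) F) ?y'" for F
    proof -
      have "laurent_eval F y = laurent_eval F (exchange (of_rat q) (perm_inv \<sigma>) (perm_inv \<sigma> s) ?y')"
        using \<sigma> nz q by (simp add: exchange_inverse)
      also have "\<dots> = laurent_eval (exchange_laurent q (perm_inv \<sigma>) (perm_inv \<sigma> s) F) ?y'"
        using \<sigma> nz' q by (intro laurent_eval_exchange) (auto simp: bij_imp_bij_inv)
      finally show ?thesis .
    qed
    from gen[of f] show ?thesis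
      unfolding pullback by blast
  qed
  ultimately show ?thesis
    using nz' by (simp add: clusters_def free_generators_iff_laurent)
qed

lemma exchange_Bij_clusters:
  fixes \<sigma> :: "'n::finite \<Rightarrow> 'n"
  assumes \<sigma>: "bij \<sigma>" and q: "q \<noteq> 0"
  shows "(\<lambda>y \<in> clusters. exchange (of_rat q :: 'a::field_char_0) \<sigma> s y) \<in> Bij clusters"
proof -
  have nz: "y i \<noteq> 0" if "y \<in> clusters" for y :: "'n \<Rightarrow> 'a" and i
    using that by (simp add: clusters_def free_generators_iff_laurent)
  have "bij_betw (exchange (of_rat q :: 'a) \<sigma> s) clusters clusters"
  proof (rule bij_betw_byWitness[where f' = "exchange (of_rat q) (perm_inv \<sigma>) (perm_inv \<sigma> s)"])
    show "\<forall>y\<in>clusters. exchange (of_rat q :: 'a) (perm_inv \<sigma>) (perm_inv \<sigma> s) (exchange (of_rat q) \<sigma> s y) = y"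
      using nz \<sigma> q by (auto intro!: exchange_inverse)
    show "\<forall>y\<in>clusters. exchange (of_rat q :: 'a) \<sigma> s (exchange (of_rat q) (perm_inv \<sigma>) (perm_inv \<sigma> s) y) = y"
    proof
      fix y :: "'n \<Rightarrow> 'a" assume "y \<in> clusters"
      \<comment> \<open>The other composite is the same cancellation law applied to the inverse
        permutation, since inverting twice gives back \<open>\<sigma>\<close> and
        \<open>s\<close>.\<close>
      then have "exchange (of_rat q) (perm_inv (perm_inv \<sigma>)) (perm_inv (perm_inv \<sigma>) (perm_inv \<sigma> s))
          (exchange (of_rat q) (perm_inv \<sigma>) (perm_inv \<sigma> s) y) = y"
        using nz \<sigma> q by (intro exchange_inverse) (auto simp: bij_imp_bij_inv)
      then show "exchange (of_rat q) \<sigma> s (exchange (of_rat q) (perm_inv \<sigma>) (perm_inv \<sigma> s) y) = y"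
        using \<sigma> by (simp add: inv_inv_eq bij_is_surj surj_f_inv_f)
    qed
  qed (auto intro!: exchange_in_clusters \<sigma> q bij_imp_bij_inv)
  then show ?thesis
    by (simp add: Bij_def)
qed

text \<open>Induction over words in the generators. For an inverse, invariance under
  \<open>h\<close> is applied at the preimage of \<open>y\<close>. Membership in
  \<open>Bij S\<close> is carried along so that intermediate points stay in
  \<open>S\<close>.\<close>

lemma generate_BijGroup_invariant:
  assumes "g \<in> generate (BijGroup S) H" "H \<subseteq> Bij S" "\<And>h y. h \<in> H \<Longrightarrow> y \<in> S \<Longrightarrow> Q (h y) = Q y"
  shows "g \<in> Bij S \<and> (\<forall>y\<in>S. Q (g y) = Q y)"
  using assms(1)
proof induction
  case one
  then show ?case using id_Bij[of S] by (simp add: BijGroup_def restrict_def)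
next
  case (incl h)
  then show ?case using assms(2,3) by blast
next
  case (inv h)
  then have h: "h \<in> Bij S" using assms(2) by blast
  have "Q (inv_into S h y) = Q y" if "y \<in> S" for y
    using assms(3)[OF inv Bij_inv_into_mem[OF h that]] h that
    by (simp add: Bij_def bij_betw_def f_inv_into_f)
  then show ?case
    unfolding inv_BijGroup[OF h] using restrict_inv_into_Bij[OF h] by (metis restrict_apply')
next
  case (eng h1 h2)
  moreover have "h2 y \<in> S" if "y \<in> S" for y
    using eng that by (auto simp: Bij_def bij_betw_def)
  ultimately show ?case
    by (simp add: BijGroup_def compose_Bij compose_eq)
qed

section \<open>Symmetries of a seed with zero matrix\<close>

lemma cluster_action_zero_matrix:
  fixes y :: "'n::finite \<Rightarrow> 'a::field_char_0"
  assumes "\<Omega> = \<lparr>exch_mat = 0, cluster = x, deg_mat = mat r, exch_poly = (\<lambda>_. Z)\<rparr>" "degree Z = r"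
  shows "cluster_action \<Omega> (permute_seed \<sigma> \<circ> mutate s)
    = (\<lambda>y \<in> clusters. exchange (of_nat (poly Z 1)) \<sigma> s y)"
proof -
  \<comment> \<open>All exponents of the cluster variables vanish with the matrix, leaving the sum
    of the coefficients of \<open>Z\<close>.\<close>
  have "exchange_rhs (\<Omega>\<lparr>cluster := y\<rparr>) s = of_nat (poly Z 1)" for y
    using assms by (simp add: exchange_rhs_def mat_def poly_altdef)
  then show ?thesis
    by (simp add: cluster_action_def permute_seed_def mutate_def Let_def exchange_def fun_eq_iff
        restrict_def assms(1))
qed

text \<open>Mutation fixes the zero matrix, and permutations fix a scalar degree matrix and a
  constant family of exchange polynomials, so no pair of \<open>\<sigma>\<close> and
  \<open>s\<close> is excluded.\<close>

lemma seed_symmetries_zero_matrix: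
  assumes "\<Omega> = \<lparr>exch_mat = 0, cluster = x, deg_mat = mat r, exch_poly = (\<lambda>_. Z)\<rparr>"
  shows "seed_symmetries \<Omega> = {permute_seed \<sigma> \<circ> mutate s | \<sigma> s. bij \<sigma>}"
proof -
  have "permute_seed \<sigma> (mutate s \<Omega>) = \<Omega>\<lparr>exch_mat := exch_mat \<Omega>,
      cluster := cluster (permute_seed \<sigma> (mutate s \<Omega>))\<rparr>" if "bij \<sigma>" for \<sigma> s
    using that bij_is_inj[OF that]
    by (simp add: assms permute_seed_def mutate_def Let_def vec_eq_iff mat_def inj_eq)
  then show ?thesis
    unfolding seed_symmetries_def by blast
qed

section \<open>Leading exponents\<close>

definition idx :: "'n::finite \<Rightarrow> nat" where
  "idx = (SOME f. bij_betw f UNIV {..<CARD('n)})"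

lemma bij_betw_idx: "bij_betw (idx :: 'n::finite \<Rightarrow> nat) UNIV {..<CARD('n)}"
proof -
  have "\<exists>f :: 'n \<Rightarrow> nat. bij_betw f UNIV {..<CARD('n)}"
    using ex_bij_betw_finite_nat[of "UNIV :: 'n set"] by (simp add: atLeast0LessThan)
  then show ?thesis
    unfolding idx_def by (rule someI_ex)
qed

lemma idx_less: "idx (i :: 'n::finite) < CARD('n)"
  using bij_betw_idx[where 'n = 'n] by (auto simp: bij_betw_def)

lemma idx_eq_iff [simp]: "idx (i :: 'n::finite) = idx j \<longleftrightarrow> i = j"
  using bij_betw_imp_inj_on[OF bij_betw_idx[where 'n = 'n]] by (simp add: inj_eq)

lemma idx_cases:
  assumes "k < CARD('n)"
  obtains i :: "'n::finite" where "idx i = k"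
proof -
  have "k \<in> range (idx :: 'n \<Rightarrow> nat)"
    using assms bij_betw_imp_surj_on[OF bij_betw_idx[where 'n = 'n]] by simp
  then show ?thesis using that by blast
qed

text \<open>
  Exponents are compared lexicographically along an arbitrary enumeration of \<open>'n\<close>; transporting them
  to \<^typ>\<open>nat \<Rightarrow>\<^sub>0 int\<close> makes the linear order on finitely supported maps available.
\<close>

definition lex_key :: "('n::finite \<Rightarrow>\<^sub>0 int) \<Rightarrow> (nat \<Rightarrow>\<^sub>0 int)" where
  "lex_key m = (\<Sum>i\<in>UNIV. single (idx i) (lookup m i))"

lemma lookup_lex_key: "lookup (lex_key m) (idx i) = lookup m i"
proof -
  have "lookup (lex_key m) (idx i) = (\<Sum>j\<in>UNIV. if j = i then lookup m i else 0)"
    unfolding lex_key_def lookup_sum by (intro sum.cong refl) (auto simp: lookup_single when_def)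
  then show ?thesis by simp
qed

lemma lookup_lex_key_beyond:
  fixes m :: "'n::finite \<Rightarrow>\<^sub>0 int"
  assumes "CARD('n) \<le> k"
  shows "lookup (lex_key m) k = 0"
proof -
  have "lookup (single (idx i) (lookup m i)) k = 0" for i
    using idx_less[of i] assms by (simp add: lookup_single_not_eq)
  then show ?thesis
    by (simp add: lex_key_def lookup_sum)
qed

lemma lex_key_add: "lex_key (m + k) = lex_key m + lex_key k"
  by (simp add: lex_key_def lookup_add single_add sum.distrib)

lemma lex_key_eq_iff [simp]: "lex_key m = lex_key k \<longleftrightarrow> m = k"
  by (metis lookup_lex_key poly_mapping_eqI)

lemma lex_key_lessI:
  fixes m k :: "'n::finite \<Rightarrow>\<^sub>0 int"
  assumes "lookup m i < lookup k i" "\<And>j. idx j < idx i \<Longrightarrow> lookup m j = lookup k j"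
  shows "lex_key m < lex_key k"
proof -
  have "lookup (lex_key m) j = lookup (lex_key k) j" if "j < idx i" for j
  proof -
    have "j < CARD('n)" using that idx_less[of i] by simp
    then show ?thesis
      using assms(2) that by (auto elim!: idx_cases simp: lookup_lex_key)
  qed
  moreover have "lookup (lex_key m) (idx i) < lookup (lex_key k) (idx i)"
    using assms(1) by (simp add: lookup_lex_key)
  ultimately show ?thesis
    unfolding less_poly_mapping.rep_eq less_fun_def by blast
qed

text \<open>
  The coefficient \<open>a\<close> may vanish; \<open>leading F m 0\<close> says that all exponents of \<open>F\<close> lie strictly below \<open>m\<close>.
\<close>

definition leading :: "'n::finite rat_laurent \<Rightarrow> ('n \<Rightarrow>\<^sub>0 int) \<Rightarrow> rat \<Rightarrow> bool" where
  "leading F m a \<longleftrightarrow> lookup F m = a \<and> (\<forall>k\<in>keys F. lex_key k \<le> lex_key m)"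

lemma leading_single [simp]: "leading (single m a) m a"
  by (simp add: leading_def)

lemma leading_1 [simp]: "leading 1 0 1"
  by (simp add: leading_def)

text \<open>Addition is strictly monotone for the order, so two exponents bounded by
  \<open>m\<close> and \<open>k\<close> sum to \<open>m + k\<close> only if both bounds are
  attained: a single product contributes to the top coefficient.\<close>

lemma leading_mult:
  assumes F: "leading F m a" and G: "leading G k b"
  shows "leading (F * G) (m + k) (a * b)"
  unfolding leading_def
proof (intro conjI ballI)
  have eq: "u + v = m + k \<longleftrightarrow> u = m \<and> v = k" if "u \<in> keys F" "v \<in> keys G" for u v
  proof
    assume uv: "u + v = m + k"
    have le: "lex_key u \<le> lex_key m" "lex_key v \<le> lex_key k"
      using F G that by (auto simp: leading_def)
    have "lex_key u + lex_key v = lex_key m + lex_key k"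
      using uv by (simp flip: lex_key_add)
    with le have "lex_key u = lex_key m" "lex_key v = lex_key k"
      by (metis add_less_le_mono add_le_less_mono less_irrefl order_le_less)+
    then show "u = m \<and> v = k" by simp
  qed simp
  have "lookup (F * G) (m + k)
      = (\<Sum>u\<in>keys F. \<Sum>v\<in>keys G. if v = k then if u = m then lookup F m * lookup G k else 0 else 0)"
    unfolding poly_mapping_mult_eq_sum_singles[of F G] lookup_sum
    by (intro sum.cong refl) (auto simp: lookup_single when_def eq)
  also have "\<dots> = (\<Sum>u\<in>keys F. if u = m then lookup F m * lookup G k else 0)"
    by (intro sum.cong refl) (auto simp: in_keys_iff)
  also have "\<dots> = lookup F m * lookup G k"
    by (auto simp: in_keys_iff)
  finally show "lookup (F * G) (m + k) = a * b"
    using F G by (simp add: leading_def)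
next
  fix l assume "l \<in> keys (F * G)"
  then obtain u v where "l = u + v" "u \<in> keys F" "v \<in> keys G"
    using Poly_Mapping.keys_mult[of F G] by blast
  then show "lex_key l \<le> lex_key (m + k)"
    using F G by (auto simp: leading_def lex_key_add intro: add_mono)
qed

lemma leading_prod:
  assumes "\<And>i. i \<in> A \<Longrightarrow> leading (P i) (e i) (a i)"
  shows "leading (\<Prod>i\<in>A. P i) (\<Sum>i\<in>A. e i) (\<Prod>i\<in>A. a i)"
  using assms by (induction A rule: infinite_finite_induct) (auto intro: leading_mult)

lemma leading_power:
  assumes "leading F m a"
  shows "leading (F ^ k) (\<Sum>i<k. m) (a ^ k)"
  using leading_prod[of "{..<k}" "\<lambda>_. F" "\<lambda>_. m" "\<lambda>_. a"] assms by (simp add: prod_constant)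

lemma leading_diff:
  assumes "leading F m a" "leading G m b"
  shows "leading (F - G) m (a - b)"
  using assms Poly_Mapping.keys_diff[of F G] by (force simp: leading_def lookup_minus)

lemma leading_add_smaller:
  assumes "leading F m a" "\<And>k. k \<in> keys G \<Longrightarrow> lex_key k < lex_key m"
  shows "leading (F + G) m a"
proof -
  have "m \<notin> keys G" using assms(2) by blast
  then have "lookup (F + G) m = a"
    using assms(1) by (simp add: leading_def lookup_add in_keys_iff)
  moreover have "lex_key k \<le> lex_key m" if "k \<in> keys (F + G)" for k
  proof -
    have "k \<in> keys F \<or> k \<in> keys G"
      using that Poly_Mapping.keys_add[of F G] by blast
    then show ?thesis
      using assms by (auto simp: leading_def intro: less_imp_le)
  qed
  ultimately show ?thesis by (simp add: leading_def)
qed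

lemma leading_zero_less:
  assumes "leading F m 0" "k \<in> keys F"
  shows "lex_key k < lex_key m"
proof -
  have "k \<noteq> m" using assms by (auto simp: leading_def in_keys_iff)
  with assms show ?thesis by (auto simp: leading_def order_le_less)
qed

lemma leading_exists:
  assumes "F \<noteq> 0"
  obtains m where "m \<in> keys F" "leading F m (lookup F m)"
proof -
  have "keys F \<noteq> {}" using assms by simp
  then have "Max (lex_key ` keys F) \<in> lex_key ` keys F"
    by (intro Max_in) auto
  then obtain m where "m \<in> keys F" "lex_key m = Max (lex_key ` keys F)"
    by force
  then show ?thesis
    using that[of m] by (simp add: leading_def)
qed

section \<open>Leading terms of the symmetric functions of \<phi>\<close>

definition laurent_phi :: "rat \<Rightarrow> 'n \<Rightarrow> 'n rat_laurent" where
  "laurent_phi q i = single (single i 1) 1 + single (single i (-1)) q"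

lemma laurent_eval_phi:
  fixes y :: "'n::finite \<Rightarrow> 'a::field_char_0"
  assumes "y i \<noteq> 0"
  shows "laurent_eval (laurent_phi q i) y = ((y i)\<^sup>2 + of_rat q) / y i"
  using assms by (simp add: laurent_phi_def laurent_eval_add laurent_eval_single
      laurent_monomial_single power_int_minus field_simps power2_eq_square)

lemma leading_phi: "leading (laurent_phi q i) (single i 1) 1"
  unfolding laurent_phi_def
proof (rule leading_add_smaller)
  fix k assume "k \<in> keys (single (single i (- 1 :: int)) q)"
  then have "k = single i (-1)" by (auto split: if_splits)
  then show "lex_key k < lex_key (single i 1)"
    by (intro lex_key_lessI[of _ i]) (auto simp: lookup_single)
qed simp

text \<open>The exponent of the product of the first \<open>k\<close> variables, lexicographically
  the largest squarefree monomial of degree \<open>k\<close>.\<close>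

definition initial_exponent :: "nat \<Rightarrow> ('n::finite \<Rightarrow>\<^sub>0 int)" where
  "initial_exponent k = (\<Sum>i | idx i < k. single i 1)"

lemma lookup_indicator_exponent:
  "lookup (\<Sum>i\<in>A. single i (1 :: int)) (j :: 'n::finite) = (if j \<in> A then 1 else 0)"
proof -
  have "lookup (\<Sum>i\<in>A. single i (1 :: int)) j = (\<Sum>i\<in>A. if i = j then 1 else 0)"
    unfolding lookup_sum by (intro sum.cong refl) (auto simp: lookup_single when_def)
  then show ?thesis by simp
qed

lemma card_initial:
  assumes "k \<le> CARD('n::finite)"
  shows "card {i :: 'n. idx i < k} = k"
proof -
  have "bij_betw idx {i :: 'n. idx i < k} {..<k}"
    unfolding bij_betw_def using assms
    by (auto intro!: inj_onI) (metis idx_cases imageI lessThan_iff mem_Collect_eq order_less_le_trans)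
  then show ?thesis
    by (simp add: bij_betw_same_card)
qed

text \<open>Equal cardinality forces \<open>A\<close> to miss some initial index. At the first
  missed one the entries are 0 and 1, while all earlier entries are 1 on both sides.\<close>

lemma indicator_less_initial:
  fixes A :: "'n::finite set"
  assumes "card A = k" "A \<noteq> {i. idx i < k}"
  shows "lex_key (\<Sum>i\<in>A. single i 1) < lex_key (initial_exponent k :: 'n \<Rightarrow>\<^sub>0 int)"
proof -
  have "k \<le> CARD('n)" using assms(1) card_mono[of UNIV A] by simp
  then have "\<not> {i. idx i < k} \<subseteq> A"
    using assms card_initial[of k, where 'n = 'n] card_subset_eq[of A "{i. idx i < k}"] by auto
  then have "\<exists>j. \<exists>i :: 'n. idx i = j \<and> idx i < k \<and> i \<notin> A" by auto
  from exists_least_iff[THEN iffD1, OF this]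
  obtain i :: 'n where i: "idx i < k" "i \<notin> A"
    and least: "\<And>j :: 'n. idx j < idx i \<Longrightarrow> \<not> (idx j < k \<and> j \<notin> A)"
    by blast
  show ?thesis
    unfolding initial_exponent_def
  proof (rule lex_key_lessI)
    show "lookup (\<Sum>j\<in>A. single j (1 :: int)) i < lookup (\<Sum>j | idx j < k. single j 1) i"
      using i by (simp add: lookup_indicator_exponent)
    show "lookup (\<Sum>j\<in>A. single j (1 :: int)) j = lookup (\<Sum>j | idx j < k. single j 1) j"
      if "idx j < idx i" for j
      using i least[OF that] that by (simp add: lookup_indicator_exponent)
  qed
qed

text \<open>The summand of a subset \<open>A\<close> leads with the indicator of \<open>A\<close>;
  the initial subset strictly dominates all others, so its coefficient 1 is not disturbed.\<close>

lemma leading_elem_sym: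
  assumes "k \<le> CARD('n::finite)"
  shows "leading (elem_sym k (laurent_phi q :: 'n \<Rightarrow> _)) (initial_exponent k) 1"
proof -
  let ?I = "{i :: 'n. idx i < k}"
  let ?\<A> = "{A. A \<subseteq> (UNIV :: 'n set) \<and> card A = k}"
  let ?P = "\<lambda>A. \<Prod>i\<in>A. laurent_phi q (i :: 'n)"
  have lead: "leading (?P A) (\<Sum>i\<in>A. single i 1) 1" for A
    using leading_prod[of A "laurent_phi q" "\<lambda>i. single i 1" "\<lambda>_. 1"] by (simp add: leading_phi)
  have "elem_sym k (laurent_phi q :: 'n \<Rightarrow> _) = ?P ?I + (\<Sum>A\<in>?\<A> - {?I}. ?P A)"
    unfolding elem_sym_def using assms by (intro sum.remove) (auto simp: card_initial)
  moreover have "leading (?P ?I + (\<Sum>A\<in>?\<A> - {?I}. ?P A)) (initial_exponent k) 1"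
  proof (rule leading_add_smaller)
    show "leading (?P ?I) (initial_exponent k) 1"
      using lead[of ?I] by (simp add: initial_exponent_def)
    fix m assume "m \<in> keys (\<Sum>A\<in>?\<A> - {?I}. ?P A)"
    then obtain A where A: "A \<in> ?\<A> - {?I}" "m \<in> keys (?P A)"
      using Poly_Mapping.keys_sum[of ?P "?\<A> - {?I}"] by blast
    then have "lex_key m \<le> lex_key (\<Sum>i\<in>A. single i 1)"
      using lead[of A] by (simp add: leading_def)
    also have "\<dots> < lex_key (initial_exponent k :: 'n \<Rightarrow>\<^sub>0 int)"
      using A by (intro indicator_less_initial) auto
    finally show "lex_key m < lex_key (initial_exponent k :: 'n \<Rightarrow>\<^sub>0 int)" .
  qed
  ultimately show ?thesis by simp
qed

text \<open>The monomial with exponents \<open>a\<close> in the symmetric functions of \<phi>, as a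
  formal Laurent polynomial. The product counts from 0, the symmetric functions from 1, hence the
  \<open>Suc\<close>.\<close>

definition sym_monomial :: "rat \<Rightarrow> (nat \<Rightarrow>\<^sub>0 nat) \<Rightarrow> 'n::finite rat_laurent" where
  "sym_monomial q a = (\<Prod>k<CARD('n). elem_sym (Suc k) (laurent_phi q) ^ lookup a (Suc k))"

text \<open>
  \<open>S\<^sub>k(\<phi>)\<close> leads with the product of the first \<open>k\<close> variables, so variable \<open>i\<close> receives one factor from
  each \<open>S\<^sub>k\<close> with \<open>k > idx i\<close> (enumeration from \<open>0\<close>).
\<close>

definition sym_exponent :: "(nat \<Rightarrow>\<^sub>0 nat) \<Rightarrow> ('n::finite \<Rightarrow>\<^sub>0 int)" where
  "sym_exponent a = Abs_poly_mapping (\<lambda>i. \<Sum>k = idx i..<CARD('n). int (lookup a (Suc k)))"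

lemma leading_sym_monomial: "leading (sym_monomial q a :: 'n::finite rat_laurent) (sym_exponent a) 1"
proof -
  let ?e = "\<Sum>k<CARD('n). \<Sum>i<lookup a (Suc k). initial_exponent (Suc k) :: 'n \<Rightarrow>\<^sub>0 int"
  have "leading (sym_monomial q a :: 'n rat_laurent) ?e (\<Prod>k<CARD('n). 1 ^ lookup a (Suc k))"
    unfolding sym_monomial_def by (intro leading_prod leading_power leading_elem_sym) simp
  moreover have "?e = sym_exponent a"
  proof (rule poly_mapping_eqI)
    fix i :: 'n
    have "lookup ?e i = (\<Sum>k<CARD('n). if idx i \<le> k then int (lookup a (Suc k)) else 0)"
      by (auto simp: lookup_sum initial_exponent_def lookup_indicator_exponent less_Suc_eq_le
          intro!: sum.cong)
    also have "\<dots> = (\<Sum>k\<in>{k\<in>{..<CARD('n)}. idx i \<le> k}. int (lookup a (Suc k)))"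
      by (rule sum.inter_filter[symmetric]) simp
    also have "{k\<in>{..<CARD('n)}. idx i \<le> k} = {idx i..<CARD('n)}"
      by auto
    finally show "lookup ?e i = lookup (sym_exponent a) i"
      by (simp add: sym_exponent_def)
  qed
  ultimately show ?thesis by simp
qed

text \<open>The entries of \<open>sym_exponent a\<close> are tail sums of \<open>a\<close>, so
  consecutive differences recover \<open>a\<close>; the empty tail at \<open>CARD('n)\<close>
  supplies the last difference.\<close>

lemma sym_exponent_inj:
  assumes "sym_exponent a = (sym_exponent b :: 'n::finite \<Rightarrow>\<^sub>0 int)"
    and "keys a \<subseteq> {1..CARD('n)}" "keys b \<subseteq> {1..CARD('n)}"
  shows "a = b"
proof (rule poly_mapping_eqI)
  define T where "T a j = (\<Sum>k = j..<CARD('n). int (lookup a (Suc k)))" for a j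
  have T: "T a j = T b j" if "j \<le> CARD('n)" for j
  proof (cases "j < CARD('n)")
    case True
    then obtain i :: 'n where "idx i = j" by (rule idx_cases)
    with arg_cong[OF assms(1), of "\<lambda>m. lookup m i"] show ?thesis
      by (simp add: sym_exponent_def T_def)
  qed (simp add: T_def)
  fix k
  show "lookup a k = lookup b k"
  proof (cases "k \<in> {1..CARD('n)}")
    case True
    then obtain j where j: "k = Suc j" "j < CARD('n)"
      by (cases k) auto
    have "T c j = int (lookup c k) + T c (Suc j)" for c
      unfolding T_def using j by (simp add: sum.atLeast_Suc_lessThan)
    with T[of j] T[of "Suc j"] j show ?thesis by simp
  next
    case False
    then have "k \<notin> keys a" "k \<notin> keys b" using assms(2,3) by blast+
    then show ?thesis by (simp add: in_keys_iff)
  qed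
qed

section \<open>Dominant exponents\<close>

text \<open>Each orbit of exponents under permutations and sign changes of the coordinates contains
  exactly one such exponent.\<close>

definition dominant :: "('n::finite \<Rightarrow>\<^sub>0 int) \<Rightarrow> bool" where
  "dominant m \<longleftrightarrow> (\<forall>i. 0 \<le> lookup m i) \<and> (\<forall>i j. idx i \<le> idx j \<longrightarrow> lookup m j \<le> lookup m i)"

text \<open>Tail sums are inverted by taking consecutive differences of the entries of
  \<open>m\<close>, which dominance makes nonnegative.\<close>

lemma sym_exponent_surj:
  fixes m :: "'n::finite \<Rightarrow>\<^sub>0 int"
  assumes "dominant m"
  obtains a where "keys a \<subseteq> {1..CARD('n)}" "sym_exponent a = m"
proof
  define g where "g = lookup (lex_key m)"
  \<comment> \<open>The entry numbered \<open>k\<close> from 1 sits at position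
    \<open>k - 1\<close>. Since \<open>g\<close> vanishes at \<open>CARD('n)\<close>, the last
    difference is the last entry itself.\<close>
  define f where "f k = (if k \<in> {1..CARD('n)} then nat (g (k - 1) - g k) else 0)" for k
  have "finite {k. f k \<noteq> 0}"
    by (rule finite_subset[of _ "{1..CARD('n)}"]) (auto simp: f_def)
  then have lookup_a: "lookup (Abs_poly_mapping f) = f"
    by simp
  show "keys (Abs_poly_mapping f) \<subseteq> {1..CARD('n)}"
    by (auto simp: in_keys_iff lookup_a f_def split: if_splits)
  have g_mono: "g (Suc k) \<le> g k" if k: "k < CARD('n)" for k
  proof -
    obtain i :: 'n where i: "idx i = k" using k by (rule idx_cases)
    show ?thesis
    proof (cases "Suc k < CARD('n)")
      case True
      then obtain j :: 'n where j: "idx j = Suc k" by (rule idx_cases)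
      have "lookup m j \<le> lookup m i"
        using assms i j by (simp add: dominant_def)
      then show ?thesis
        by (metis g_def i j lookup_lex_key)
    next
      case False
      then have "g (Suc k) = 0"
        by (simp add: g_def lookup_lex_key_beyond)
      moreover have "0 \<le> g k"
        using assms by (metis dominant_def g_def i lookup_lex_key)
      ultimately show ?thesis by simp
    qed
  qed
  show "sym_exponent (Abs_poly_mapping f) = m"
  proof (rule poly_mapping_eqI)
    fix i :: 'n
    have "(\<Sum>k = idx i..<CARD('n). int (f (Suc k))) = (\<Sum>k = idx i..<CARD('n). g k - g (Suc k))"
      using g_mono by (intro sum.cong refl) (auto simp: f_def)
    also have "\<dots> = g (idx i) - g CARD('n)"
      using sum_Suc_diff'[of "idx i" "CARD('n)" "\<lambda>k. - g k"] idx_less[of i] by simp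
    also have "\<dots> = lookup m i"
      by (simp add: g_def lookup_lex_key lookup_lex_key_beyond)
    finally show "lookup (sym_exponent (Abs_poly_mapping f)) i = lookup m i"
      by (simp add: sym_exponent_def lookup_a)
  qed
qed

text \<open>The lexicographic bound controls only the first entry, but dominance traps all entries
  between 0 and the first one.\<close>

lemma finite_dominant_below: "finite {d :: 'n::finite \<Rightarrow>\<^sub>0 int. dominant d \<and> lex_key d \<le> lex_key (m :: 'n \<Rightarrow>\<^sub>0 int)}"
proof -
  obtain i0 :: 'n where i0: "idx i0 = 0"
    by (rule idx_cases[of 0]) auto
  have "{d :: 'n \<Rightarrow>\<^sub>0 int. dominant d \<and> lex_key d \<le> lex_key m} \<subseteq> lookup -` (UNIV \<rightarrow>\<^sub>E {0..lookup m i0})"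
  proof
    fix d :: "'n \<Rightarrow>\<^sub>0 int" assume d: "d \<in> {d. dominant d \<and> lex_key d \<le> lex_key m}"
    have "lookup d i0 \<le> lookup m i0"
    proof (rule ccontr)
      assume "\<not> lookup d i0 \<le> lookup m i0"
      then have "lex_key m < lex_key d"
        by (intro lex_key_lessI[of _ i0]) (auto simp: i0)
      with d show False using leD by blast
    qed
    moreover have "0 \<le> lookup d i" "lookup d i \<le> lookup d i0" for i
      using d i0 by (auto simp: dominant_def)
    ultimately have "lookup d i \<in> {0..lookup m i0}" for i
      by (meson atLeastAtMost_iff order_trans)
    then show "d \<in> lookup -` (UNIV \<rightarrow>\<^sub>E {0..lookup m i0})"
      by (simp add: PiE_UNIV_domain)
  qed
  moreover have "finite (lookup -` (UNIV \<rightarrow>\<^sub>E {0..lookup m i0}) :: ('n \<Rightarrow>\<^sub>0 int) set)"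
  proof (rule finite_vimageI)
    show "finite ((UNIV :: 'n set) \<rightarrow>\<^sub>E {0..lookup m i0})"
      by (rule finite_PiE) simp_all
    show "inj (lookup :: ('n \<Rightarrow>\<^sub>0 int) \<Rightarrow> 'n \<Rightarrow> int)"
      by (rule injI) (rule poly_mapping_eqI, rule fun_cong)
  qed
  ultimately show ?thesis
    by (rule finite_subset)
qed

text \<open>A negative entry could be flipped and an ascending pair swapped; either move stays among
  the exponents of \<open>F\<close> and is lexicographically larger, contradicting
  maximality.\<close>

lemma leading_exponent_dominant:
  fixes x :: "'n::finite \<Rightarrow> 'a::field_char_0"
  assumes ind: "laurent_independent x" and nz: "\<And>i. x i \<noteq> 0" and q: "q \<noteq> 0"
    and inv: "\<And>\<sigma> s. bij \<sigma> \<Longrightarrow> laurent_eval F (exchange (of_rat q) \<sigma> s x) = laurent_eval F x"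
    and m: "m \<in> keys F" "leading F m a"
  shows "dominant m"
proof -
  have closed: "exchange_exponent \<sigma> s k \<in> keys F" if "bij \<sigma>" "k \<in> keys F" for \<sigma> s k
  proof -
    \<comment> \<open>Independence of \<open>x\<close> upgrades the equality of values to an
      equality of Laurent polynomials, so symmetries map exponents of \<open>F\<close> to exponents
      of \<open>F\<close>.\<close>
    have "laurent_eval (exchange_laurent q \<sigma> s F - F) x = 0"
      using inv[OF that(1), of s] laurent_eval_exchange[of \<sigma> x q F s] that(1) nz q
      by (simp add: laurent_eval_diff)
    then have "exchange_laurent q \<sigma> s F - F = 0"
      using ind by (simp only: laurent_independent_def)
    then have "exchange_laurent q \<sigma> s F = F" by simp
    with exchange_exponent_in_keys[OF that(1) q that(2)] show ?thesis by metis
  qed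
  have max: "\<not> lex_key m < lex_key k" if "k \<in> keys F" for k
    using m(2) that by (auto simp: leading_def not_less)
  have nonneg: "0 \<le> lookup m i" for i
  proof (rule ccontr)
    assume "\<not> 0 \<le> lookup m i"
    then have "lex_key m < lex_key (exchange_exponent id i m)"
      by (intro lex_key_lessI[of _ i]) (auto simp: exchange_exponent_def)
    with max[OF closed[OF bij_id m(1)]] show False by blast
  qed
  have mono: "lookup m j \<le> lookup m i" if "idx i < idx j" for i j
  proof (rule ccontr)
    assume less: "\<not> lookup m j \<le> lookup m i"
    define \<tau> where "\<tau> = Transposition.transpose i j"
    \<comment> \<open>Every generator flips a sign. A second exchange at the same index undoes the
      flip, so the composite is the bare transposition.\<close>
    define k where "k = exchange_exponent id i (exchange_exponent \<tau> i m)"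
    have "bij \<tau>" by (simp add: \<tau>_def)
    then have "k \<in> keys F"
      unfolding k_def by (intro closed m(1)) auto
    moreover have "lookup k l = lookup m (\<tau> l)" for l
    proof -
      have "perm_inv \<tau> = \<tau>" by (simp add: \<tau>_def inv_unique_comp)
      then show ?thesis
        by (simp add: k_def exchange_exponent_def)
    qed
    then have "lex_key m < lex_key k"
      using less that by (intro lex_key_lessI[of _ i]) (auto simp: \<tau>_def Transposition.transpose_def)
    ultimately show False using max by blast
  qed
  show ?thesis
    unfolding dominant_def using nonneg mono by (metis idx_eq_iff order_le_less order_refl)
qed

section \<open>Invariance of the symmetric functions of \<phi>\<close>

lemma elem_sym_permute:
  fixes f :: "'n::finite \<Rightarrow> 'a::comm_ring_1"
  assumes "bij \<sigma>"
  shows "elem_sym k (\<lambda>i. f (\<sigma> i)) = elem_sym k f"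
proof -
  have inj: "inj \<sigma>" and surj: "surj \<sigma>" using assms by (auto simp: bij_is_inj bij_is_surj)
  show ?thesis
    unfolding elem_sym_def
  proof (rule sum.reindex_bij_witness[where i = "\<lambda>A. \<sigma> -` A" and j = "\<lambda>A. \<sigma> ` A"])
    show "(\<Prod>i\<in>\<sigma> ` A. f i) = (\<Prod>i\<in>A. f (\<sigma> i))" for A
      using inj by (subst prod.reindex) (auto intro: inj_on_subset)
  qed (use inj surj in \<open>auto simp: inj_vimage_image_eq surj_image_vimage_eq card_image inj_on_subset
      card_vimage_inj\<close>)
qed

lemma laurent_eval_elem_sym:
  fixes y :: "'n::finite \<Rightarrow> 'a::field_char_0"
  assumes "\<And>i. y i \<noteq> 0"
  shows "laurent_eval (elem_sym k (laurent_phi q)) y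
    = elem_sym k (\<lambda>i. ((y i)\<^sup>2 + of_rat q) / y i)"
  by (simp add: elem_sym_def laurent_eval_sum laurent_eval_prod laurent_eval_phi assms)

lemma laurent_eval_sym_monomial:
  fixes y :: "'n::finite \<Rightarrow> 'a::field_char_0"
  assumes "\<And>i. y i \<noteq> 0" "keys a \<subseteq> {1..CARD('n)}"
  shows "laurent_eval (sym_monomial q a) y
    = mpoly_monomial (\<lambda>k. elem_sym k (\<lambda>i. ((y i)\<^sup>2 + of_rat q) / y i)) a"
proof -
  let ?S = "\<lambda>k. elem_sym k (\<lambda>i. ((y i)\<^sup>2 + of_rat q) / y i)"
  have "laurent_eval (sym_monomial q a) y = (\<Prod>k<CARD('n). ?S (Suc k) ^ lookup a (Suc k))"
    by (simp add: sym_monomial_def laurent_eval_prod laurent_eval_power laurent_eval_elem_sym assms(1))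
  also have "\<dots> = (\<Prod>k\<in>Suc ` {..<CARD('n)}. ?S k ^ lookup a k)"
    by (simp add: prod.reindex)
  also have "Suc ` {..<CARD('n)} = {1..CARD('n)}"
    by (simp add: image_Suc_lessThan)
  also have "(\<Prod>k\<in>{1..CARD('n)}. ?S k ^ lookup a k) = mpoly_monomial ?S a"
    unfolding mpoly_monomial_def using assms(2)
    by (intro prod.mono_neutral_right) (auto simp: in_keys_iff)
  finally show ?thesis .
qed

text \<open>The expression \<open>z + c / z\<close> is unchanged under replacing \<open>z\<close> by
  \<open>c / z\<close>; the remaining permutation is absorbed by symmetry.\<close>

lemma sym_poly_exchange:
  fixes y :: "'n::finite \<Rightarrow> 'a::field_char_0"
  assumes "bij \<sigma>" "\<And>i. y i \<noteq> 0" "c \<noteq> 0"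
  shows "elem_sym k (\<lambda>i. ((exchange c \<sigma> s y i)\<^sup>2 + c) / exchange c \<sigma> s y i)
    = elem_sym k (\<lambda>i. ((y i)\<^sup>2 + c) / y i)"
proof -
  have "((exchange c \<sigma> s y i)\<^sup>2 + c) / exchange c \<sigma> s y i = ((y (\<sigma> i))\<^sup>2 + c) / y (\<sigma> i)" for i
    using assms(2,3) by (auto simp: exchange_def field_simps power2_eq_square)
  then show ?thesis
    using elem_sym_permute[OF assms(1), of k "\<lambda>i. ((y i)\<^sup>2 + c) / y i"] by simp
qed

section \<open>Invariants\<close>

lemma invariant_laurent_in_generated_algebra:
  fixes x :: "'n::finite \<Rightarrow> 'a::field_char_0"
  assumes ind: "laurent_independent x" and nz: "\<And>i. x i \<noteq> 0" and q: "q \<noteq> 0"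
    and inv: "\<And>\<sigma> s. bij \<sigma> \<Longrightarrow> laurent_eval F (exchange (of_rat q) \<sigma> s x) = laurent_eval F x"
  shows "laurent_eval F x
    \<in> generated_algebra {1..CARD('n)} (\<lambda>k. elem_sym k (\<lambda>i. ((x i)\<^sup>2 + of_rat q) / x i))"
proof -
  define S :: "('n \<Rightarrow> 'a) \<Rightarrow> nat \<Rightarrow> 'a" where
    "S y k = elem_sym k (\<lambda>i. ((y i)\<^sup>2 + of_rat q) / y i)" for y k
  \<comment> \<open>The cardinality of this set is the induction measure. For nonzero
    \<open>F\<close> it consists of the dominant exponents up to the leading one, hence is
    finite.\<close>
  define below :: "'n rat_laurent \<Rightarrow> ('n \<Rightarrow>\<^sub>0 int) set" where
    "below F = {d. dominant d \<and> (\<exists>k\<in>keys F. lex_key d \<le> lex_key k)}" for F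
  have "\<exists>p\<in>mpolys_in {1..CARD('n)}. laurent_eval F x = mpoly_eval p (S x)"
    using inv
  proof (induction "card (below F)" arbitrary: F rule: less_induct)
    case less
    show ?case
    proof (cases "F = 0")
      case True
      then show ?thesis
        by (intro bexI[of _ 0]) (auto simp: mpoly_eval_def mpolys_in_def)
    next
      case False
      then obtain m where m: "m \<in> keys F" and lead: "leading F m (lookup F m)"
        by (rule leading_exists)
      have dom: "dominant m"
        using leading_exponent_dominant[OF ind nz q less.prems m lead] .
      then obtain a where a: "keys a \<subseteq> {1..CARD('n)}" "sym_exponent a = m"
        by (rule sym_exponent_surj)
      \<comment> \<open>The multiple of a monomial in the symmetric functions with the same leading
        term as \<open>F\<close>. It is itself invariant, so \<open>F - E\<close> again meets the
        induction premise.\<close>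
      define E :: "'n rat_laurent" where "E = single 0 (lookup F m) * sym_monomial q a"
      have E_eval: "laurent_eval E y = of_rat (lookup F m) * mpoly_monomial (S y) a"
        if "\<And>i. y i \<noteq> 0" for y :: "'n \<Rightarrow> 'a"
        using that a(1)
        by (simp add: E_def S_def[abs_def] laurent_eval_mult laurent_eval_single laurent_eval_sym_monomial)
      have "S (exchange (of_rat q) \<sigma> s x) = S x" if "bij \<sigma>" for \<sigma> s
        using sym_poly_exchange[of \<sigma> x "of_rat q"] that nz q by (simp add: S_def[abs_def])
      then have E_inv: "laurent_eval E (exchange (of_rat q) \<sigma> s x) = laurent_eval E x" if "bij \<sigma>" for \<sigma> s
        using that nz q by (simp add: E_eval exchange_nonzero)
      have "leading E (0 + m) (lookup F m * 1)"
        unfolding E_def using leading_sym_monomial[of q a, where 'n = 'n] a(2)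
        by (intro leading_mult) auto
      then have "leading (F - E) m 0"
        using leading_diff[OF lead, of E "lookup F m"] by simp
      then have smaller: "lex_key k < lex_key m" if "k \<in> keys (F - E)" for k
        using that by (rule leading_zero_less)
      have "finite (below F)"
      proof (rule finite_subset)
        show "below F \<subseteq> {d. dominant d \<and> lex_key d \<le> lex_key m}"
          using lead by (auto simp: below_def leading_def intro: order_trans)
      qed (rule finite_dominant_below)
      \<comment> \<open>All exponents of \<open>F - E\<close> lie strictly below \<open>m\<close>,
        so the dominant exponent \<open>m\<close> leaves the set and nothing enters.\<close>
      moreover have "below (F - E) \<subset> below F"
      proof
        show "below (F - E) \<subseteq> below F"
          using smaller m by (auto simp: below_def) (meson less_imp_le order_trans)
        have "m \<notin> below (F - E)"
          using smaller leD by (auto simp: below_def)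
        moreover have "m \<in> below F"
          using m dom by (auto simp: below_def)
        ultimately show "below (F - E) \<noteq> below F" by blast
      qed
      ultimately have "card (below (F - E)) < card (below F)"
        by (rule psubset_card_mono)
      moreover have "laurent_eval (F - E) (exchange (of_rat q) \<sigma> s x) = laurent_eval (F - E) x"
        if "bij \<sigma>" for \<sigma> s
        using less.prems[OF that] E_inv[OF that] by (simp add: laurent_eval_diff)
      ultimately obtain p where p: "p \<in> mpolys_in {1..CARD('n)}"
        "laurent_eval (F - E) x = mpoly_eval p (S x)"
        using less.hyps by blast
      show ?thesis
      proof
        have "keys (p + single a (lookup F m)) \<subseteq> keys p \<union> {a}"
          using Poly_Mapping.keys_add[of p "single a (lookup F m)"] by (auto split: if_splits)
        then show "p + single a (lookup F m) \<in> mpolys_in {1..CARD('n)}"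
          using p(1) a(1) by (auto simp: mpolys_in_def)
        have "laurent_eval F x = laurent_eval (F - E) x + laurent_eval E x"
          by (simp add: laurent_eval_diff)
        also have "\<dots> = mpoly_eval (p + single a (lookup F m)) (S x)"
          using p(2) E_eval[OF nz] by (simp add: mpoly_eval_lin_ext lin_ext_add)
        finally show "laurent_eval F x = mpoly_eval (p + single a (lookup F m)) (S x)" .
      qed
    qed
  qed
  then show ?thesis
    by (auto simp: generated_algebra_def S_def[abs_def])
qed

section \<open>Algebraic independence of the symmetric functions\<close>

text \<open>Formal substitution of the symmetric functions into \<open>p\<close>. It gives one
  Laurent polynomial that represents the result at every cluster simultaneously.\<close>

definition sym_laurent :: "rat \<Rightarrow> nat rat_mpoly \<Rightarrow> 'n::finite rat_laurent" where
  "sym_laurent q p = (\<Sum>a\<in>keys p. single 0 (lookup p a) * sym_monomial q a)"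

lemma laurent_eval_sym_laurent:
  fixes y :: "'n::finite \<Rightarrow> 'a::field_char_0"
  assumes "\<And>i. y i \<noteq> 0" "p \<in> mpolys_in {1..CARD('n)}"
  shows "laurent_eval (sym_laurent q p) y
    = mpoly_eval p (\<lambda>k. elem_sym k (\<lambda>i. ((y i)\<^sup>2 + of_rat q) / y i))"
  unfolding sym_laurent_def laurent_eval_sum mpoly_eval_lin_ext lin_ext_def using assms
  by (intro sum.cong refl)
    (simp add: laurent_eval_mult laurent_eval_single laurent_eval_sym_monomial mpolys_in_def)

text \<open>Different monomials of \<open>p\<close> have different leading exponents, so the largest
  of these receives a contribution from one monomial only and cannot cancel.\<close>

lemma sym_laurent_eq_0D:
  assumes "sym_laurent q p = (0 :: 'n::finite rat_laurent)" "p \<in> mpolys_in {1..CARD('n)}"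
  shows "p = 0"
proof (rule ccontr)
  let ?e = "\<lambda>a. sym_exponent a :: 'n \<Rightarrow>\<^sub>0 int"
  assume "p \<noteq> 0"
  then have "keys p \<noteq> {}" by simp
  then have "Max ((\<lambda>a. lex_key (?e a)) ` keys p) \<in> (\<lambda>a. lex_key (?e a)) ` keys p"
    by (intro Max_in) auto
  then obtain a where a: "a \<in> keys p" and "lex_key (?e a) = Max ((\<lambda>a. lex_key (?e a)) ` keys p)"
    by force
  then have max: "lex_key (?e b) \<le> lex_key (?e a)" if "b \<in> keys p" for b
    using that by simp
  \<comment> \<open>Any other monomial of \<open>p\<close> leads strictly below \<open>?e a\<close>,
    so \<open>?e a\<close> is not among its exponents.\<close>
  have coeff: "lookup (sym_monomial q b) (?e a) = (if b = a then 1 else 0)" if b: "b \<in> keys p" for b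
  proof (cases "b = a")
    case True
    then show ?thesis
      using leading_sym_monomial[of q a, where 'n = 'n] by (simp add: leading_def)
  next
    case False
    have "?e b \<noteq> ?e a"
      using sym_exponent_inj[of b a, where 'n = 'n] False a b assms(2) by (auto simp: mpolys_in_def)
    then have "lex_key (?e b) < lex_key (?e a)"
      using max[OF b] by (simp add: order_less_le)
    then have "?e a \<notin> keys (sym_monomial q b)"
      using leading_sym_monomial[of q b, where 'n = 'n] leD unfolding leading_def by blast
    with False show ?thesis by (simp add: in_keys_iff)
  qed
  have "lookup (single 0 c * G) m = c * lookup G m" for c and G :: "'n rat_laurent" and m
    by (simp flip: mult_map_scale_conv_mult add: Poly_Mapping.map.rep_eq when_def)
  then have "lookup (sym_laurent q p) (?e a)
      = (\<Sum>b\<in>keys p. lookup p b * lookup (sym_monomial q b) (?e a))"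
    by (simp add: sym_laurent_def lookup_sum)
  also have "\<dots> = (\<Sum>b\<in>keys p. if b = a then lookup p a else 0)"
    by (intro sum.cong refl) (auto simp: coeff)
  also have "\<dots> = lookup p a"
    using a by simp
  finally have "lookup p a = 0"
    using assms(1) by simp
  with a show False by (simp add: in_keys_iff)
qed

theorem proposition3p21:
  fixes \<Omega>\<^sub>0 :: "('n::finite, 'a::field_char_0) seed"
    and x :: "'n \<Rightarrow> 'a"
    and r :: nat
    and Z :: "nat poly"
    and c :: 'a
    and \<phi> :: "'n \<Rightarrow> 'a"
  assumes "is_seed \<Omega>\<^sub>0"
    and "\<Omega>\<^sub>0 = \<lparr>exch_mat = 0, cluster = x, deg_mat = mat r, exch_poly = (\<lambda>_. Z)\<rparr>"
    and "r > 0"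
    and "c = of_nat (poly Z 1)"
    and "\<phi> = (\<lambda>k. ((x k)\<^sup>2 + c) / x k)"
  shows "invariant_laurent (symmetry_group \<Omega>\<^sub>0) x =
           generated_algebra {1..CARD('n)} (\<lambda>k. elem_sym k \<phi>)
         \<and> algebraically_independent {1..CARD('n)} (\<lambda>k. elem_sym k \<phi>)"
proof -
  \<comment> \<open>The constant \<open>c\<close> as a rational number, since Laurent polynomials
    have rational coefficients while \<open>c\<close> lives in the ambient field.\<close>
  define q :: rat where "q = of_nat (poly Z 1)"
  define S :: "('n \<Rightarrow> 'a) \<Rightarrow> nat \<Rightarrow> 'a" where
    "S y k = elem_sym k (\<lambda>i. ((y i)\<^sup>2 + of_rat q) / y i)" for y k
  have c: "c = of_rat q"
    using assms(4) by (simp add: q_def)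
  have S: "(\<lambda>k. elem_sym k \<phi>) = S x"
    by (simp add: assms(5) S_def[abs_def] c)
  have seed: "degree Z = r" "coeff Z 0 = 1" "free_generators x"
    using assms(1,2) by (auto simp: is_seed_def Let_def mat_def)
  have "poly Z 1 = (\<Sum>i\<le>degree Z. coeff Z i)"
    by (simp add: poly_altdef)
  \<comment> \<open>A sum of natural numbers that contains the constant coefficient 1.\<close>
  then have "poly Z 1 \<noteq> 0"
    using seed(2) by (auto intro: bexI[of _ 0])
  then have q: "q \<noteq> 0"
    by (simp add: q_def)
  have x: "x \<in> clusters"
    using seed(3) by (simp add: clusters_def)
  have nz: "y i \<noteq> 0" if "y \<in> clusters" for y :: "'n \<Rightarrow> 'a" and i
    using that by (simp add: clusters_def free_generators_iff_laurent)
  have ind: "laurent_independent x"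
    using seed(3) by (simp add: free_generators_iff_laurent)
  have action: "cluster_action \<Omega>\<^sub>0 (permute_seed \<sigma> \<circ> mutate s)
      = (\<lambda>y\<in>clusters. exchange (of_rat q) \<sigma> s y)" for \<sigma> s
    using cluster_action_zero_matrix[OF assms(2) seed(1)] by (simp add: q_def)
  have "cluster_action \<Omega>\<^sub>0 ` seed_symmetries \<Omega>\<^sub>0
      = {cluster_action \<Omega>\<^sub>0 (permute_seed \<sigma> \<circ> mutate s) | \<sigma> s. bij \<sigma>}"
    unfolding seed_symmetries_zero_matrix[OF assms(2)] by blast
  then have gens: "cluster_action \<Omega>\<^sub>0 ` seed_symmetries \<Omega>\<^sub>0
      = {\<lambda>y\<in>clusters. exchange (of_rat q) \<sigma> s y | \<sigma> s. bij \<sigma>}"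
    by (simp only: action)
  \<comment> \<open>The tuple of symmetric functions is fixed by the generators, hence by the whole
    group; the \<open>Bij\<close> part guarantees that \<open>g x\<close> is again a
    cluster.\<close>
  have group: "g \<in> Bij clusters \<and> (\<forall>y\<in>clusters. S (g y) = S y)" if "g \<in> symmetry_group \<Omega>\<^sub>0" for g
  proof (rule generate_BijGroup_invariant)
    show "g \<in> generate (BijGroup clusters) {\<lambda>y\<in>clusters. exchange (of_rat q) \<sigma> s y | \<sigma> s. bij \<sigma>}"
      using that by (simp only: symmetry_group_def gens)
    show "{\<lambda>y\<in>clusters. exchange (of_rat q) \<sigma> s y | \<sigma> s. bij \<sigma>}
        \<subseteq> Bij (clusters :: ('n \<Rightarrow> 'a) set)"
      by clarify (intro exchange_Bij_clusters q)
    fix h :: "('n \<Rightarrow> 'a) \<Rightarrow> ('n \<Rightarrow> 'a)" and y :: "'n \<Rightarrow> 'a"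
    assume "h \<in> {\<lambda>y\<in>clusters. exchange (of_rat q) \<sigma> s y | \<sigma> s. bij \<sigma>}" "y \<in> clusters"
    then obtain \<sigma> s where "bij \<sigma>" "h y = exchange (of_rat q) \<sigma> s y"
      by auto
    with \<open>y \<in> clusters\<close> show "S (h y) = S y"
      using sym_poly_exchange[of \<sigma> y "of_rat q"] nz q by (simp add: S_def[abs_def])
  qed
  have "invariant_laurent (symmetry_group \<Omega>\<^sub>0) x = generated_algebra {1..CARD('n)} (S x)"
  proof
    show "invariant_laurent (symmetry_group \<Omega>\<^sub>0) x \<subseteq> generated_algebra {1..CARD('n)} (S x)"
    proof
      fix f assume "f \<in> invariant_laurent (symmetry_group \<Omega>\<^sub>0) x"
      then obtain F where F: "f = laurent_eval F x"
        "\<And>g. g \<in> symmetry_group \<Omega>\<^sub>0 \<Longrightarrow> laurent_eval F (g x) = laurent_eval F x"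
        by (auto simp: invariant_laurent_def)
      have "laurent_eval F (exchange (of_rat q) \<sigma> s x) = laurent_eval F x" if "bij \<sigma>" for \<sigma> s
      proof -
        have "(\<lambda>y\<in>clusters. exchange (of_rat q) \<sigma> s y) \<in> symmetry_group \<Omega>\<^sub>0"
          unfolding symmetry_group_def gens using that by (blast intro: generate.incl)
        from F(2)[OF this] x show ?thesis by simp
      qed
      then have "laurent_eval F x \<in> generated_algebra {1..CARD('n)} (S x)"
        unfolding S_def[abs_def]
        by (intro invariant_laurent_in_generated_algebra ind nz[OF x] q)
      with F(1) show "f \<in> generated_algebra {1..CARD('n)} (S x)" by simp
    qed
    show "generated_algebra {1..CARD('n)} (S x) \<subseteq> invariant_laurent (symmetry_group \<Omega>\<^sub>0) x"
    proof
      fix f assume "f \<in> generated_algebra {1..CARD('n)} (S x)"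
      then obtain p where p: "p \<in> mpolys_in {1..CARD('n)}" "f = mpoly_eval p (S x)"
        by (auto simp: generated_algebra_def)
      \<comment> \<open>The same Laurent polynomial computes \<open>p\<close> of the symmetric
        functions at \<open>x\<close> and at \<open>g x\<close>, so invariance of \<open>S\<close>
        carries over to it.\<close>
      have eval: "laurent_eval (sym_laurent q p) y = mpoly_eval p (S y)" if "y \<in> clusters"
        for y :: "'n \<Rightarrow> 'a"
        using laurent_eval_sym_laurent[OF nz[OF that] p(1)] by (simp add: S_def[abs_def])
      have "laurent_eval (sym_laurent q p) (g x) = laurent_eval (sym_laurent q p) x"
        if "g \<in> symmetry_group \<Omega>\<^sub>0" for g
      proof -
        have "g x \<in> clusters" "S (g x) = S x"
          using group[OF that] x Bij_imp_funcset by blast+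
        with x show ?thesis by (simp add: eval)
      qed
      then show "f \<in> invariant_laurent (symmetry_group \<Omega>\<^sub>0) x"
        unfolding invariant_laurent_def p(2) eval[OF x, symmetric] by blast
    qed
  qed
  moreover have "algebraically_independent {1..CARD('n)} (S x)"
    unfolding algebraically_independent_def
  proof (intro ballI impI)
    fix p assume p: "p \<in> mpolys_in {1..CARD('n)}" "mpoly_eval p (S x) = 0"
    \<comment> \<open>A relation among the symmetric functions of \<phi> is a Laurent relation for
      \<open>x\<close>, so it holds formally by independence of \<open>x\<close>.\<close>
    then have "laurent_eval (sym_laurent q p) x = 0"
      using laurent_eval_sym_laurent[OF nz[OF x] p(1), of q] by (simp add: S_def[abs_def])
    then have "sym_laurent q p = (0 :: 'n rat_laurent)"
      using ind by (simp add: laurent_independent_def)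
    with p(1) show "p = 0" by (rule sym_laurent_eq_0D[rotated])
  qed
  ultimately show ?thesis
    by (simp add: S)
qed

end
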